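(* Let $\sigma:\mathbb{R}^d\to\mathbb{R}^{d\times m}$ and $b:\mathbb{R}^d\to\mathbb{R}^d$ be continuous and assume there exist constants $C>0$ and $\mu>0$ such that for every integer $N>e$ and all $x,y\in\mathbb{R}^d$ with $|x|\le N$, $|y|\le N$, $$\|\sigma(x)-\sigma(y)\|\le C\sqrt{\log N}\,|x-y|+C\frac{\log N}{N^{\mu}},\qquad |b(x)-b(y)|\le C\log N\,|x-y|+C\frac{\log N}{N^{\mu}}.$$ Let $(X_t)$ and $(Y_t)$ be two solutions with continuous sample paths and without explosion of the SDE $$X_t=x+\int_0^t b(X_s)\,ds+\int_0^t\sigma(X_s)\,dW_s$$ such that $X_0=Y_0=x$ almost surely. Then for any $T>0$, almost surely $X_t=Y_t$ for all $0\le t\le T$.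
   Context: $(\Omega,\mathcal{F},(\mathcal{F}_t),\mathbb{P})$ is a complete filtered probability space with right-continuous filtration whose $\sigma$-fields contain all $\mathbb{P}$-null sets, and $(W_t)_{t\ge0}$ is an $\mathbb{R}^m$-valued standard $(\mathcal{F}_t)$-Brownian motion; both solutions are defined on this space with this Brownian motion. $|\cdot|$ is the Euclidean norm on $\mathbb{R}^d$ and $\|\sigma\|^2=\sum_{i=1}^d\sum_{j=1}^m\sigma_{ij}^2$. *)

theory Defs
  imports "HOL-Probability.Probability"
begin

definition complete_measure_space :: "'a measure \<Rightarrow> bool" where
  "complete_measure_space M \<longleftrightarrow> (\<forall>N\<in>null_sets M. \<forall>A. A \<subseteq> N \<longrightarrow> A \<in> sets M)"

definition usual_filtration :: "'a measure \<Rightarrow> (real \<Rightarrow> 'a set set) \<Rightarrow> bool" where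
  "usual_filtration M F \<longleftrightarrow>
     (\<forall>t\<ge>0. sigma_algebra (space M) (F t) \<and> F t \<subseteq> sets M) \<and>
     (\<forall>s t. 0 \<le> s \<longrightarrow> s \<le> t \<longrightarrow> F s \<subseteq> F t) \<and>
     (\<forall>t\<ge>0. F t = (\<Inter>u\<in>{t<..}. F u)) \<and>
     (\<forall>t\<ge>0. null_sets M \<subseteq> F t)"

definition adapted_process ::
  "'a measure \<Rightarrow> (real \<Rightarrow> 'a set set) \<Rightarrow> (real \<Rightarrow> 'a \<Rightarrow> 'b::topological_space) \<Rightarrow> bool" where
  "adapted_process M F X \<longleftrightarrow>
     (\<forall>t\<ge>0. \<forall>B\<in>sets borel. {\<omega>\<in>space M. X t \<omega> \<in> B} \<in> F t)"

definition gauss_density :: "real \<Rightarrow> real^'m \<Rightarrow> real" where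
  "gauss_density h v = (2 * pi * h) powr (- real CARD('m) / 2) * exp (- (norm v)\<^sup>2 / (2 * h))"

definition brownian_motion ::
  "'a measure \<Rightarrow> (real \<Rightarrow> 'a set set) \<Rightarrow> (real \<Rightarrow> 'a \<Rightarrow> real^'m) \<Rightarrow> bool" where
  "brownian_motion M F W \<longleftrightarrow>
     adapted_process M F W \<and>
     (AE \<omega> in M. W 0 \<omega> = 0) \<and>
     (AE \<omega> in M. continuous_on {0..} (\<lambda>t. W t \<omega>)) \<and>
     (\<forall>s t. 0 \<le> s \<longrightarrow> s < t \<longrightarrow>
        (\<forall>A\<in>F s. \<forall>B\<in>sets borel.
           measure M (A \<inter> {\<omega>\<in>space M. W t \<omega> - W s \<omega> \<in> B})
             = measure M A * measure M {\<omega>\<in>space M. W t \<omega> - W s \<omega> \<in> B}) \<and>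
        distr M borel (\<lambda>\<omega>. W t \<omega> - W s \<omega>)
          = density lborel (\<lambda>v. ennreal (gauss_density (t - s) v)))"

definition ito_riemann_sum ::
  "(real \<Rightarrow> 'a \<Rightarrow> real^'m^'d) \<Rightarrow> (real \<Rightarrow> 'a \<Rightarrow> real^'m) \<Rightarrow> real \<Rightarrow> nat \<Rightarrow> 'a \<Rightarrow> real^'d" where
  "ito_riemann_sum H W t n \<omega> =
     (\<Sum>k<2^n. H (t * real k / 2^n) \<omega> *v
                 (W (t * real (Suc k) / 2^n) \<omega> - W (t * real k / 2^n) \<omega>))"

text \<open>I is (a version of) the Ito integral \<integral>_0^t H_s dW_s of a continuous adapted integrand H:
  the limit in probability of the left-point Riemann sums.\<close>
definition is_ito_integral ::
  "'a measure \<Rightarrow> (real \<Rightarrow> 'a \<Rightarrow> real^'m) \<Rightarrow> (real \<Rightarrow> 'a \<Rightarrow> real^'m^'d) \<Rightarrow> real \<Rightarrow> ('a \<Rightarrow> real^'d) \<Rightarrow> bool" where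
  "is_ito_integral M W H t I \<longleftrightarrow>
     I \<in> borel_measurable M \<and>
     (\<forall>\<epsilon>>0. (\<lambda>n. measure M {\<omega>\<in>space M. norm (ito_riemann_sum H W t n \<omega> - I \<omega>) > \<epsilon>})
               \<longlonglongrightarrow> 0)"

text \<open>Solution (continuous, adapted, non-exploding, i.e. real-valued for all t \<ge> 0) of
  X_t = x + \<integral>_0^t b(X_s) ds + \<integral>_0^t \<sigma>(X_s) dW_s.\<close>
definition sde_solution ::
  "'a measure \<Rightarrow> (real \<Rightarrow> 'a set set) \<Rightarrow> (real \<Rightarrow> 'a \<Rightarrow> real^'m) \<Rightarrow>
   (real^'d \<Rightarrow> real^'m^'d) \<Rightarrow> (real^'d \<Rightarrow> real^'d) \<Rightarrow> real^'d \<Rightarrow> (real \<Rightarrow> 'a \<Rightarrow> real^'d) \<Rightarrow> bool" where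
  "sde_solution M F W \<sigma> b x X \<longleftrightarrow>
     adapted_process M F X \<and>
     (AE \<omega> in M. continuous_on {0..} (\<lambda>t. X t \<omega>)) \<and>
     (AE \<omega> in M. X 0 \<omega> = x) \<and>
     (\<forall>t\<ge>0. \<exists>I. is_ito_integral M W (\<lambda>s \<omega>. \<sigma> (X s \<omega>)) t I \<and>
        (AE \<omega> in M. X t \<omega> = x + integral {0..t} (\<lambda>s. b (X s \<omega>)) + I \<omega>))"

end

theory Submission
  imports Defs "HOL-Real_Asymp.Real_Asymp"
begin

text \<open>
  For a bound \<open>R\<close> on both paths, put \<open>\<phi>(t) = E[|X\<^sub>t - Y\<^sub>t|\<^sup>2; |X|, |Y| \<le> R on [0, t]]\<close>. On this event
  \<open>X\<^sub>t - Y\<^sub>t\<close> is an almost sure limit of Riemann sums whose terms may be multiplied by the indicators of the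
  (adapted, decreasing) events \<open>|X|, |Y| \<le> R on [0, t\<^sub>k]\<close>, so a discrete Ito isometry and Fatou's lemma bound
  \<open>\<phi>(t)\<close> by values \<open>\<phi>(t\<^sub>k)\<close>; neither stopping times nor Ito's formula are needed. The moduli of continuity are
  available for every \<open>N \<ge> R\<close>. Measured in the weight \<open>exp (2K ln N (t - s))\<close> with a large constant \<open>K\<close>, the
  Lipschitz parts become a contraction by \<open>1/2\<close>, so if \<open>\<phi>\<close> vanishes on \<open>[0, s]\<close> then
  \<open>\<phi>(t) \<le> c (ln N)\<^sup>2 N powr (2K(t - s) - 2\<mu>)\<close>. Letting \<open>N \<rightarrow> \<infinity>\<close> extends the zero set of \<open>\<phi>\<close> by the fixed length
  \<open>\<mu>/(2K)\<close>, and finitely many such steps reach any time.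
\<close>

subsection \<open>Riemann sums, Gaussian moments and modes of convergence\<close>

text \<open>The stochastic integral is given only as a limit in probability of left-point dyadic
  sums, so all estimates are made on sums of fixed mesh, with bounds uniform in the mesh. The
  obstacle is the additive error in the moduli, which does not vanish for \<open>y = z\<close>: no
  single \<open>N\<close> yields uniqueness, and a Gronwall bound over a long interval costs a power
  of \<open>N\<close> larger than the error gains. On a step of length at most
  \<open>\<mu> / (2 * K)\<close> the weight costs at most \<open>N powr \<mu>\<close>, while the
  squared error is of order \<open>N powr (- 2 * \<mu>)\<close> up to logarithms, so a negative
  power survives. The step length depends on neither \<open>R\<close> nor \<open>N\<close> nor the
  starting time, hence the argument can be restarted. The different growth of the two moduli is what
  makes the contraction possible: with rate \<open>l = K * ln N\<close> the drift contributes
  \<open>(ln N)^2 / l^2\<close> and the noise, whose \<open>sqrt (ln N)\<close> is squared by the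
  isometry, contributes \<open>ln N / l\<close>; both ratios are free of \<open>N\<close>. Nothing
  about \<phi> as a function of time is used beyond boundedness, and so the Gronwall argument works
  with a weighted supremum instead of an integral inequality.\<close>

text \<open>By uniform continuity each cell contributes an error of at most \<open>e'\<close> times
  its length. Induction over the number \<open>m\<close> of cells, at fixed mesh, adds these up to
  \<open>e' * t\<close>.\<close>

lemma dyadic_riemann_sum_tendsto_integral:
  fixes f :: "real \<Rightarrow> 'a::banach"
  assumes t: "0 \<le> t" and f: "continuous_on {0..t} f"
  shows "(\<lambda>n. \<Sum>k<2^n. (t / 2^n) *\<^sub>R f (t * real k / 2^n)) \<longlonglongrightarrow> integral {0..t} f"
proof (rule LIMSEQ_I)
  fix e :: real assume e: "0 < e"
  \<comment> \<open>The summand 1 keeps the denominator positive at \<open>t = 0\<close>, and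
    \<open>e' * t < e\<close> holds in all cases.\<close>
  define e' where "e' = e / (2 * (t + 1))"
  have e': "0 < e'" using e t by (simp add: e'_def)
  have "uniformly_continuous_on {0..t} f"
    using f by (intro compact_uniformly_continuous) auto
  then obtain d where d: "0 < d"
    "\<And>r s. r \<in> {0..t} \<Longrightarrow> s \<in> {0..t} \<Longrightarrow> dist r s < d \<Longrightarrow> dist (f r) (f s) < e'"
    using e' unfolding uniformly_continuous_on_def by metis
  have "(\<lambda>n. t * (1 / 2) ^ n) \<longlonglongrightarrow> t * 0"
    by (intro tendsto_mult tendsto_const LIMSEQ_power_zero) auto
  then have "eventually (\<lambda>n. t * (1 / 2) ^ n < d) sequentially"
    using d(1) by (intro order_tendstoD) auto
  then obtain n0 where n0: "\<And>n. n \<ge> n0 \<Longrightarrow> t / 2 ^ n < d"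
    by (auto simp: eventually_sequentially power_one_over)
  show "\<exists>no. \<forall>n\<ge>no. norm ((\<Sum>k<2^n. (t / 2^n) *\<^sub>R f (t * real k / 2^n)) - integral {0..t} f) < e"
  proof (intro exI allI impI)
    fix n assume n: "n0 \<le> n"
    define h where "h = t / 2^n"
    have h: "0 \<le> h" "h < d" "h * 2^n = t" using n0[OF n] t by (auto simp: h_def)
    have "norm ((\<Sum>k<m. h *\<^sub>R f (h * real k)) - integral {0..h * real m} f) \<le> e' * (h * real m)"
      if "m \<le> 2^n" for m
      using that
    proof (induction m)
      case (Suc m)
      have le: "h * real (Suc m) \<le> t"
        using Suc.prems h by (metis mult_left_mono of_nat_le_iff of_nat_numeral of_nat_power)
      have le': "h * real m \<le> h * real (Suc m)" using h by (intro mult_left_mono) auto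
      have int: "f integrable_on {0..h * real (Suc m)}"
        by (intro integrable_continuous_real continuous_on_subset[OF f]) (use le in auto)
      have comb: "integral {0..h * real m} f + integral {h * real m..h * real (Suc m)} f
          = integral {0..h * real (Suc m)} f"
        by (rule Henstock_Kurzweil_Integration.integral_combine[OF _ le' int]) (use h in simp)
      have bnd: "norm (integral {h * real m..h * real (Suc m)} (\<lambda>s. f s - f (h * real m)))
          \<le> e' * (h * real (Suc m) - h * real m)"
      proof (rule integral_bound)
        show "continuous_on {h * real m..h * real (Suc m)} (\<lambda>s. f s - f (h * real m))"
          using h le by (intro continuous_intros continuous_on_subset[OF f]) auto
        fix s assume s: "s \<in> {h * real m..h * real (Suc m)}"
        then have "dist s (h * real m) < d" using h by (auto simp: dist_real_def algebra_simps)
        moreover have "0 \<le> h * real m" using h by simp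
        ultimately have "dist (f s) (f (h * real m)) < e'"
          using s le le' by (intro d) auto
        then show "norm (f s - f (h * real m)) \<le> e'" by (simp add: dist_norm)
      qed (use le' in auto)
      have dif: "integral {h * real m..h * real (Suc m)} (\<lambda>s. f s - f (h * real m))
          = integral {h * real m..h * real (Suc m)} f - h *\<^sub>R f (h * real m)"
        using h le le'
        by (subst integral_diff)
           (auto intro!: integrable_continuous_real continuous_on_subset[OF f] order_trans[OF mult_nonneg_nonneg[OF h(1) of_nat_0_le_iff[of m]]] simp: algebra_simps)
      have IH: "norm ((\<Sum>k<m. h *\<^sub>R f (h * real k)) - integral {0..h * real m} f) \<le> e' * (h * real m)"
        using Suc by simp
      have
        "norm ((\<Sum>k<m. h *\<^sub>R f (h * real k)) - integral {0..h * real m} f)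
          + norm (integral {0..h * real (Suc m)} f - integral {0..h * real m} f - h *\<^sub>R f (h * real m))
          \<le> e' * (h * real m) + e' * (h * real (Suc m) - h * real m)"
        using add_mono[OF IH bnd] unfolding dif comb[symmetric] by simp
      moreover have "norm (a + c - i') \<le> norm (a - i) + norm (i' - i - c)" for a c i i' :: 'a
        using norm_triangle_ineq4[of "a - i" "i' - i - c"] by (simp add: algebra_simps)
      ultimately have "norm ((\<Sum>k<Suc m. h *\<^sub>R f (h * real k)) - integral {0..h * real (Suc m)} f)
          \<le> e' * (h * real m) + e' * (h * real (Suc m) - h * real m)"
        unfolding sum.lessThan_Suc by (meson order_trans)
      then show ?case by (simp add: algebra_simps)
    qed (use h in auto)
    from this[of "2^n"] have "norm ((\<Sum>k<2^n. h *\<^sub>R f (h * real k)) - integral {0..t} f) \<le> e' * t"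
      using h(3) by simp
    also have "e' * t < e" using e t by (simp add: e'_def field_simps add_nonneg_pos)
    finally show "norm ((\<Sum>k<2^n. (t / 2^n) *\<^sub>R f (t * real k / 2^n)) - integral {0..t} f) < e"
      by (simp add: h_def)
  qed
qed

text \<open>Since \<open>a * h \<le> exp (a * h) - 1\<close>, each summand is at most the increment
  of \<open>exp (a * r) / a\<close> over its cell, and the increments telescope. The bound does not
  depend on the mesh, and its factor \<open>1 / a\<close> is the gain that later beats the
  logarithms.\<close>

lemma exp_left_riemann_sum_le:
  fixes a h :: real
  assumes "0 < a" "0 \<le> h"
  shows "(\<Sum>k<m. h * exp (a * (h * real k))) \<le> exp (a * (h * real m)) / a"
proof -
  have "(\<Sum>k<m. h * exp (a * (h * real k))) \<le> (exp (a * (h * real m)) - 1) / a"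
  proof (induction m)
    case (Suc m)
    have "a * h \<le> exp (a * h) - 1" using exp_ge_add_one_self[of "a * h"] by linarith
    then have "a * h * exp (a * (h * real m)) \<le> (exp (a * h) - 1) * exp (a * (h * real m))"
      by (intro mult_right_mono) auto
    also have "\<dots> = exp (a * (h * real (Suc m))) - exp (a * (h * real m))"
      by (simp add: algebra_simps exp_add)
    finally show ?case using Suc assms by (simp add: field_simps)
  qed simp
  also have "\<dots> \<le> exp (a * (h * real m)) / a" using assms by (simp add: divide_right_mono)
  finally show ?thesis .
qed

section \<open>Coordinatewise integration and Gaussian moments\<close>

text \<open>Lebesgue measure on a Euclidean space is the image of the product of one-dimensional
  Lebesgue measures under \<open>g \<mapsto> (\<Sum>b\<in>Basis. g b *\<^sub>R b)\<close>, so the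
  integral of a product of functions of single coordinates factorizes.\<close>

lemma
  fixes f :: "'a::euclidean_space \<Rightarrow> real \<Rightarrow> real"
  assumes f: "\<And>b. b \<in> Basis \<Longrightarrow> integrable lborel (f b)"
  shows integrable_lborel_prod: "integrable lborel (\<lambda>x. \<Prod>b\<in>Basis. f b (x \<bullet> b))"
    and integral_lborel_prod:
      "(\<integral>x. (\<Prod>b\<in>Basis. f b (x \<bullet> b)) \<partial>lborel) = (\<Prod>b\<in>Basis. \<integral>x. f b x \<partial>lborel)"
proof -
  interpret product_sigma_finite "\<lambda>b::'a. lborel :: real measure" ..
  have [measurable]: "b \<in> Basis \<Longrightarrow> f b \<in> borel_measurable borel" for b
    using borel_measurable_integrable[OF f] by simp
  have coord: "(\<Prod>b\<in>Basis. f b ((\<Sum>c\<in>Basis. g c *\<^sub>R c) \<bullet> b)) = (\<Prod>b\<in>Basis. f b (g b))" for g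
    by (intro prod.cong refl) simp
  have m: "(\<lambda>x::'a. \<Prod>b\<in>Basis. f b (x \<bullet> b)) \<in> borel_measurable borel" by measurable
  have g: "(\<lambda>g. \<Sum>b\<in>Basis. g b *\<^sub>R b :: 'a) \<in> measurable (\<Pi>\<^sub>M b\<in>Basis. lborel) borel"
    by measurable
  show "integrable lborel (\<lambda>x. \<Prod>b\<in>Basis. f b (x \<bullet> b))"
    unfolding lborel_eq[where 'a='a] using product_integrable_prod[OF finite_Basis f]
    by (subst integrable_distr_eq[OF g m]) (simp add: coord)
  show "(\<integral>x. (\<Prod>b\<in>Basis. f b (x \<bullet> b)) \<partial>lborel) = (\<Prod>b\<in>Basis. \<integral>x. f b x \<partial>lborel)"
    unfolding lborel_eq[where 'a='a] using product_integral_prod[OF finite_Basis f]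
    by (subst integral_distr[OF g m]) (simp add: coord)
qed

lemma gauss_density_eq_prod:
  fixes v :: "real^'m"
  assumes h: "0 < h"
  shows "gauss_density h v = (\<Prod>b\<in>Basis. normal_density 0 (sqrt h) (v \<bullet> b))"
proof -
  have "(norm v)\<^sup>2 = (\<Sum>b\<in>Basis. (v \<bullet> b)\<^sup>2)"
    unfolding power2_norm_eq_inner by (subst euclidean_inner) (simp add: power2_eq_square)
  then have "- (norm v)\<^sup>2 / (2 * h) = (\<Sum>b\<in>Basis. - (v \<bullet> b)\<^sup>2 / (2 * h))"
    by (simp add: sum_negf sum_divide_distrib)
  then have "exp (- (norm v)\<^sup>2 / (2 * h)) = (\<Prod>b\<in>Basis. exp (- (v \<bullet> b)\<^sup>2 / (2 * h)))"
    by (simp only: exp_sum[OF finite_Basis])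
  moreover have "(2 * pi * h) powr (- real CARD('m) / 2) = (1 / sqrt (2 * pi * h)) ^ CARD('m)"
  proof -
    have "(2 * pi * h) powr (- real CARD('m) / 2) = ((2 * pi * h) powr (- (1/2))) powr real CARD('m)"
      by (simp add: powr_powr)
    also have "(2 * pi * h) powr (- (1/2)) = 1 / sqrt (2 * pi * h)"
      unfolding powr_minus by (subst powr_half_sqrt) (use h in \<open>simp_all add: divide_inverse\<close>)
    finally show ?thesis using h by (subst (asm) powr_realpow) simp_all
  qed
  ultimately show ?thesis
    using h unfolding gauss_density_def normal_density_def prod.distrib by simp
qed

text \<open>The density and the monomial both factor over the coordinates, leaving one-dimensional
  normal moments: a coordinate that occurs once contributes its mean 0, one that occurs twice
  contributes the variance \<open>h\<close>, and all others contribute total mass 1.\<close>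

lemma
  fixes i j :: "'m::finite"
  assumes h: "0 < h"
  shows integrable_gauss_density_moment2: "integrable lborel (\<lambda>v::real^'m. gauss_density h v * (v $ i * v $ j))"
    and integral_gauss_density_moment2:
      "(\<integral>v. gauss_density h (v::real^'m) * (v $ i * v $ j) \<partial>lborel) = (if i = j then h else 0)"
    and integrable_gauss_density_moment1: "integrable lborel (\<lambda>v::real^'m. gauss_density h v * v $ i)"
    and integral_gauss_density_moment1: "(\<integral>v. gauss_density h (v::real^'m) * v $ i \<partial>lborel) = 0"
proof -
  let ?n = "normal_density 0 (sqrt h)"
  have s: "0 < sqrt h" using h by simp
  have n: "integrable lborel (\<lambda>x. ?n x * x ^ k)" for k
    using integrable_normal_moment[OF s, of 0 k] by simp
  have n1: "integrable lborel (\<lambda>x. ?n x * x)" and n2: "integrable lborel (\<lambda>x. ?n x * (x * x))"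
    using n[of 1] n[of 2] by (simp_all add: power2_eq_square)
  have i1: "(\<integral>x. ?n x * x \<partial>lborel) = 0"
    using integral_normal_moment_nz_1[OF s, of 0] by simp
  have i2: "(\<integral>x. ?n x * (x * x) \<partial>lborel) = h"
    using integral_normal_moment_even[OF s, of 0 1] h by (simp add: power2_eq_square fact_numeral)
  \<comment> \<open>The sets \<open>A\<close> and \<open>B\<close> mark the coordinates that carry a
    factor \<open>x\<close>. Keeping two sets lets \<open>i = j\<close> put a square into one
    coordinate, and \<open>B = {}\<close> covers the first moment.\<close>
  let ?f = "\<lambda>(A::(real^'m) set) B b x. ?n x * (if b \<in> A then x else 1) * (if b \<in> B then x else 1)"
  have f: "integrable lborel (?f A B b)" for A B b
    using n1 n2 s by (cases "b \<in> A"; cases "b \<in> B") (simp_all add: mult.assoc)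
  have ax: "v $ k = (\<Prod>b\<in>Basis. if b \<in> {axis k 1} then v \<bullet> b else 1)" for k and v :: "real^'m"
    by (simp add: prod.delta' inner_axis axis_in_Basis_iff prod.inter_restrict[symmetric])
  have e2: "gauss_density h v * (v $ i * v $ j) = (\<Prod>b\<in>Basis. ?f {axis i 1} {axis j 1} b (v \<bullet> b))" for v
    unfolding gauss_density_eq_prod[OF h] ax[of v i] ax[of v j] by (simp add: prod.distrib mult.assoc)
  have e1: "gauss_density h v * v $ i = (\<Prod>b\<in>Basis. ?f {axis i 1} {} b (v \<bullet> b))" for v
    unfolding gauss_density_eq_prod[OF h] ax[of v i] by (simp add: prod.distrib mult.assoc)
  show "integrable lborel (\<lambda>v::real^'m. gauss_density h v * (v $ i * v $ j))"
    unfolding e2 by (rule integrable_lborel_prod[OF f])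
  show "integrable lborel (\<lambda>v::real^'m. gauss_density h v * v $ i)"
    unfolding e1 by (rule integrable_lborel_prod[OF f])
  have ib: "axis k 1 \<in> (Basis :: (real^'m) set)" for k by (simp add: axis_in_Basis_iff)
  show "(\<integral>v. gauss_density h (v::real^'m) * v $ i \<partial>lborel) = 0"
    unfolding e1 integral_lborel_prod[OF f] using ib[of i] i1
    by (intro prod_zero) (auto intro!: bexI[of _ "axis i 1"])
  show "(\<integral>v. gauss_density h (v::real^'m) * (v $ i * v $ j) \<partial>lborel) = (if i = j then h else 0)"
  proof (cases "i = j")
    case True
    have "(\<Prod>b\<in>(Basis::(real^'m) set). \<integral>x. ?f {axis i 1} {axis j 1} b x \<partial>lborel)
        = (\<Prod>b\<in>(Basis::(real^'m) set). if b = axis i 1 then h else 1)"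
      using True i2 s by (intro prod.cong) (auto simp: mult.assoc)
    then show ?thesis unfolding e2 integral_lborel_prod[OF f] using True ib[of i]
      by (simp add: prod.delta')
  next
    case False
    then have "axis i (1::real) \<noteq> axis j 1" by (simp add: axis_eq_axis)
    then show ?thesis unfolding e2 integral_lborel_prod[OF f] using ib[of i] i1 False
      by (auto intro!: prod_zero bexI[of _ "axis i 1"])
  qed
qed

section \<open>Weighted sums and elementary inequalities\<close>

lemma dyadic_exp_sum_le:
  fixes a t s :: real
  assumes "0 < a" "0 \<le> t"
  shows "(\<Sum>k<2^n. (t / 2^n) * exp (a * (t * real k / 2^n - s))) \<le> exp (a * (t - s)) / a"
proof -
  have "(\<Sum>k<2^n. (t / 2^n) * exp (a * (t * real k / 2^n - s)))
      = (\<Sum>k<2^n. (t / 2^n) * exp (a * (t / 2^n * real k))) * exp (- (a * s))"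
    unfolding sum_distrib_right by (intro sum.cong refl) (simp add: mult.assoc exp_add[symmetric] algebra_simps)
  also have "\<dots> \<le> exp (a * (t / 2^n * real (2^n))) / a * exp (- (a * s))"
    using assms by (intro mult_right_mono exp_left_riemann_sum_le) auto
  also have "\<dots> = exp (a * (t - s)) / a"
    by (simp add: exp_add[symmetric] algebra_simps)
  finally show ?thesis .
qed

text \<open>Cauchy-Schwarz for the splitting
  \<open>h * d = sqrt (h * w) * (sqrt (h / w) * d)\<close>. With mesh \<open>h\<close> and an
  exponential \<open>w\<close>, both resulting sums are controlled by
  \<open>dyadic_exp_sum_le\<close>; each yields one factor \<open>1 / l\<close>.\<close>

lemma weighted_sum_squared_le:
  fixes d w h :: "'i \<Rightarrow> real"
  assumes "\<And>i. i \<in> A \<Longrightarrow> 0 < w i" "\<And>i. i \<in> A \<Longrightarrow> 0 \<le> h i"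
  shows "(\<Sum>i\<in>A. h i * d i)\<^sup>2 \<le> (\<Sum>i\<in>A. h i * w i) * (\<Sum>i\<in>A. h i * (d i)\<^sup>2 / w i)"
proof -
  have "(\<Sum>i\<in>A. h i * d i) = (\<Sum>i\<in>A. sqrt (h i * w i) * (sqrt (h i / w i) * d i))"
  proof (intro sum.cong refl)
    fix i assume i: "i \<in> A"
    have "sqrt (h i * w i) * sqrt (h i / w i) = sqrt ((h i)\<^sup>2)"
      unfolding real_sqrt_mult[symmetric] using assms(1)[OF i] by (simp add: power2_eq_square)
    then have "sqrt (h i * w i) * sqrt (h i / w i) = h i" using assms(2)[OF i] by simp
    then show "h i * d i = sqrt (h i * w i) * (sqrt (h i / w i) * d i)" by (simp only: mult.assoc[symmetric])
  qed
  then have "(\<Sum>i\<in>A. h i * d i)\<^sup>2 \<le> (\<Sum>i\<in>A. (sqrt (h i * w i))\<^sup>2) * (\<Sum>i\<in>A. (sqrt (h i / w i) * d i)\<^sup>2)"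
    using Cauchy_Schwarz_ineq_sum[of "\<lambda>i. sqrt (h i * w i)" "\<lambda>i. sqrt (h i / w i) * d i" A] by simp
  also have "(\<Sum>i\<in>A. (sqrt (h i * w i))\<^sup>2) = (\<Sum>i\<in>A. h i * w i)"
    using assms by (intro sum.cong refl) (simp add: less_imp_le)
  also have "(\<Sum>i\<in>A. (sqrt (h i / w i) * d i)\<^sup>2) = (\<Sum>i\<in>A. h i * (d i)\<^sup>2 / w i)"
    using assms by (intro sum.cong refl) (simp add: less_imp_le power_mult_distrib)
  finally show ?thesis .
qed

lemma sum_power2_le: "(a + b)\<^sup>2 \<le> 2 * a\<^sup>2 + 2 * b\<^sup>2" for a b :: real
  using zero_le_power2[of "a - b"] by (simp add: power2_eq_square algebra_simps)

lemma sum3_power2_le: "(a + b + c)\<^sup>2 \<le> 3 * a\<^sup>2 + 3 * b\<^sup>2 + 3 * c\<^sup>2" for a b c :: real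
  using zero_le_power2[of "a - b"] zero_le_power2[of "b - c"] zero_le_power2[of "a - c"]
  by (simp add: power2_eq_square algebra_simps)

section \<open>Passing from countable and probabilistic information to paths\<close>

text \<open>Reduces a condition over all times to countably many. This serves twice: for the
  measurability of events about a whole path, and, with \<open>R = 0\<close>, to extend equality of
  two paths from countably many times.\<close>

lemma norm_le_if_norm_le_on_rationals:
  fixes f :: "real \<Rightarrow> 'b::real_normed_vector"
  assumes f: "continuous_on {0..t} f"
    and le: "\<And>r. r \<in> insert t (\<rat> \<inter> {0..t}) \<Longrightarrow> norm (f r) \<le> R"
    and s: "s \<in> {0..t}"
  shows "norm (f s) \<le> R"
proof (cases "0 < t")
  case True
  have sub: "{0..t} \<subseteq> closure (\<rat> \<inter> {0..t})"
  proof
    fix x assume x: "x \<in> {0..t}"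
    show "x \<in> closure (\<rat> \<inter> {0..t})"
      unfolding closure_approachable
    proof (intro allI impI)
      fix e :: real assume "0 < e"
      then have "max 0 (x - e) < min t (x + e)" using x True by auto
      from Rats_dense_in_real[OF this] obtain y where "y \<in> \<rat>" "max 0 (x - e) < y" "y < min t (x + e)"
        by auto
      then show "\<exists>y\<in>\<rat> \<inter> {0..t}. dist y x < e"
        by (intro bexI[of _ y]) (auto simp: dist_real_def)
    qed
  qed
  have "closure (\<rat> \<inter> {0..t}) \<subseteq> {0..t}" by (rule closure_minimal) auto
  with sub have "closure (\<rat> \<inter> {0..t}) = {0..t}" by auto
  then show ?thesis
    using continuous_le_on_closure[of "\<rat> \<inter> {0..t}" "\<lambda>s. norm (f s)" s R] f le s
    by (auto intro: continuous_on_norm)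
next
  case False
  then have "s = t" using s by simp
  then show ?thesis using le[of t] by simp
qed

text \<open>Truncating the distance at 1 makes it integrable, and its mean is at most
  \<open>e / 2\<close> plus the probability that the distance exceeds \<open>e / 2\<close>. Hence
  the truncated distances converge in mean and a subsequence converges almost surely; near 0 the
  truncation has no effect.\<close>

lemma (in prob_space) tendsto_in_probability_AE_subseq:
  fixes U :: "nat \<Rightarrow> 'a \<Rightarrow> 'b::{banach, second_countable_topology}"
  assumes U [measurable]: "\<And>n. U n \<in> borel_measurable M" and I [measurable]: "I \<in> borel_measurable M"
    and lim: "\<And>e. 0 < e \<Longrightarrow> (\<lambda>n. prob {\<omega>\<in>space M. norm (U n \<omega> - I \<omega>) > e}) \<longlonglongrightarrow> 0"
  obtains r :: "nat \<Rightarrow> nat" where "strict_mono r" "AE \<omega> in M. (\<lambda>n. U (r n) \<omega>) \<longlonglongrightarrow> I \<omega>"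
proof -
  define u where "u n \<omega> = min 1 (norm (U n \<omega> - I \<omega>))" for n \<omega>
  have um [measurable]: "u n \<in> borel_measurable M" for n unfolding u_def by measurable
  have ui: "integrable M (u n)" for n
    by (rule integrable_const_bound[where B = 1]) (auto simp: u_def)
  have "(\<lambda>n. \<integral>\<omega>. norm (u n \<omega>) \<partial>M) \<longlonglongrightarrow> 0"
  proof (rule LIMSEQ_I)
    fix e :: real assume e: "0 < e"
    let ?A = "\<lambda>n. {\<omega>\<in>space M. norm (U n \<omega> - I \<omega>) > e / 2}"
    have "eventually (\<lambda>n. prob (?A n) < e / 2) sequentially"
      using lim[of "e / 2"] e by (intro order_tendstoD) auto
    then obtain n0 where n0: "\<And>n. n0 \<le> n \<Longrightarrow> prob (?A n) < e / 2"
      by (auto simp: eventually_sequentially)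
    have le: "(\<integral>\<omega>. norm (u n \<omega>) \<partial>M) \<le> e / 2 + prob (?A n)" for n
    proof -
      have A: "?A n \<in> events" by measurable
      have i: "integrable M (indicat_real (?A n))"
        by (rule integrable_real_indicator[OF A]) (simp add: emeasure_eq_measure)
      have "(\<integral>\<omega>. norm (u n \<omega>) \<partial>M) \<le> (\<integral>\<omega>. e / 2 + indicat_real (?A n) \<omega> \<partial>M)"
      proof (rule integral_mono)
        show "integrable M (\<lambda>\<omega>. norm (u n \<omega>))" by (rule integrable_norm[OF ui])
        show "integrable M (\<lambda>\<omega>. e / 2 + indicat_real (?A n) \<omega>)"
          by (rule Bochner_Integration.integrable_add[OF integrable_const i])
        show "norm (u n \<omega>) \<le> e / 2 + indicat_real (?A n) \<omega>" if "\<omega> \<in> space M" for \<omega>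
          using e that by (auto simp: u_def indicator_def)
      qed
      also have "\<dots> = e / 2 + prob (?A n)"
        using A by (subst Bochner_Integration.integral_add[OF integrable_const i]) (simp add: prob_space)
      finally show ?thesis .
    qed
    have "norm ((\<integral>\<omega>. norm (u n \<omega>) \<partial>M) - 0) < e" if "n0 \<le> n" for n
    proof -
      have "0 \<le> (\<integral>\<omega>. norm (u n \<omega>) \<partial>M)" by (intro Bochner_Integration.integral_nonneg norm_ge_zero)
      with n0[OF that] le[of n] show ?thesis unfolding diff_0_right real_norm_def[of "integral\<^sup>L M _"] by linarith
    qed
    then show "\<exists>no. \<forall>n\<ge>no. norm ((\<integral>\<omega>. norm (u n \<omega>) \<partial>M) - 0) < e" by auto
  qed
  from tendsto_L1_AE_subseq[OF ui this] obtain r where r: "strict_mono r"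
    and lim: "AE \<omega> in M. (\<lambda>n. u (r n) \<omega>) \<longlonglongrightarrow> 0" by auto
  have "AE \<omega> in M. (\<lambda>n. U (r n) \<omega>) \<longlonglongrightarrow> I \<omega>"
    using lim
  proof (rule AE_mp, intro AE_I2 impI)
    fix \<omega> assume l: "(\<lambda>n. u (r n) \<omega>) \<longlonglongrightarrow> 0"
    then have "eventually (\<lambda>n. u (r n) \<omega> < 1) sequentially" by (intro order_tendstoD) auto
    then have "eventually (\<lambda>n. u (r n) \<omega> = norm (U (r n) \<omega> - I \<omega>)) sequentially"
      by (rule eventually_mono) (simp add: u_def min_def split: if_splits)
    from Lim_transform_eventually[OF l this] show "(\<lambda>n. U (r n) \<omega>) \<longlonglongrightarrow> I \<omega>"
      unfolding tendsto_norm_zero_iff by (rule LIM_zero_cancel)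
  qed
  with r show thesis by (rule that)
qed

lemma borel_measurable_matrix_vector_mult:
  fixes A :: "'a \<Rightarrow> real^'m^'d"
  assumes "A \<in> borel_measurable N" "v \<in> borel_measurable N"
  shows "(\<lambda>x. A x *v v x) \<in> borel_measurable N"
  by (rule borel_measurable_continuous_Pair[OF assms])
     (unfold matrix_vector_mult_def, intro continuous_intros)

text \<open>Fatou's lemma, which yields an upper bound for the limit without any uniform
  integrability. The alternative \<open>f x = 0\<close> admits points where \<open>g n x\<close>
  need not converge, since there any nonnegative sequence dominates.\<close>

lemma integral_le_if_AE_tendsto:
  fixes f :: "'a \<Rightarrow> real"
  assumes f: "integrable M f" "\<And>x. 0 \<le> f x" and g: "\<And>n. integrable M (g n)" "\<And>n x. 0 \<le> g n x"
    and c: "\<And>n. integral\<^sup>L M (g n) \<le> c"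
    and lim: "AE x in M. f x = 0 \<or> (\<lambda>n. g n x) \<longlonglongrightarrow> f x"
  shows "integral\<^sup>L M f \<le> c"
proof -
  have c0: "0 \<le> c" by (rule order_trans[OF Bochner_Integration.integral_nonneg[OF g(2)] c])
  have "ennreal (integral\<^sup>L M f) = (\<integral>\<^sup>+x. ennreal (f x) \<partial>M)"
    using f by (intro nn_integral_eq_integral[symmetric]) auto
  also have "\<dots> \<le> (\<integral>\<^sup>+x. liminf (\<lambda>n. ennreal (g n x)) \<partial>M)"
  proof (rule nn_integral_mono_AE)
    show "AE x in M. ennreal (f x) \<le> liminf (\<lambda>n. ennreal (g n x))"
      using lim
    proof (rule AE_mp, intro AE_I2 impI)
      fix x assume "f x = 0 \<or> (\<lambda>n. g n x) \<longlonglongrightarrow> f x"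
      then show "ennreal (f x) \<le> liminf (\<lambda>n. ennreal (g n x))"
      proof
        assume "(\<lambda>n. g n x) \<longlonglongrightarrow> f x"
        then have "(\<lambda>n. ennreal (g n x)) \<longlonglongrightarrow> ennreal (f x)" by (rule tendsto_ennrealI)
        from lim_imp_Liminf[OF sequentially_bot this] show ?thesis by simp
      qed simp
    qed
  qed
  also have "\<dots> \<le> liminf (\<lambda>n. \<integral>\<^sup>+x. ennreal (g n x) \<partial>M)"
    using g by (intro nn_integral_liminf) (auto intro!: measurable_compose[OF _ measurable_ennreal] borel_measurable_integrable)
  also have "\<dots> \<le> ennreal c"
  proof (rule Liminf_le[OF sequentially_bot], intro always_eventually allI)
    fix n
    have "(\<integral>\<^sup>+x. ennreal (g n x) \<partial>M) = ennreal (integral\<^sup>L M (g n))"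
      using g by (intro nn_integral_eq_integral) auto
    then show "(\<integral>\<^sup>+x. ennreal (g n x) \<partial>M) \<le> ennreal c" using c[of n] by (simp add: ennreal_leI)
  qed
  finally show ?thesis using c0 by (simp add: ennreal_le_iff)
qed

subsection \<open>Brownian increments and the discrete Ito isometry\<close>

lemma borel_measurable_vec_component:
  fixes f :: "'a \<Rightarrow> real^'n"
  assumes "f \<in> borel_measurable N"
  shows "(\<lambda>x. f x $ i) \<in> borel_measurable N"
  by (rule measurable_compose[OF assms]) (intro borel_measurable_continuous_onI continuous_intros)

locale brownian_space = prob_space M for M :: "'a measure" +
  fixes F :: "real \<Rightarrow> 'a set set" and W :: "real \<Rightarrow> 'a \<Rightarrow> real^'m"
  assumes complete: "complete_measure_space M"
    and usual: "usual_filtration M F"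
    and brownian: "brownian_motion M F W"
begin

text \<open>Packages the family \<open>F t\<close> of events as a measure, so that adaptedness
  becomes ordinary measurability and the usual closure rules apply to it.\<close>

definition FM :: "real \<Rightarrow> 'a measure" where "FM t = sigma (space M) (F t)"

lemma space_FM [simp]: "space (FM t) = space M"
  by (simp add: FM_def space_measure_of_conv)

lemma
  assumes "0 \<le> t"
  shows sigma_algebra_F: "sigma_algebra (space M) (F t)"
    and F_subset_events: "F t \<subseteq> events"
    and null_sets_subset_F: "null_sets M \<subseteq> F t"
  using conjunct1[OF usual[unfolded usual_filtration_def], rule_format, OF assms]
    conjunct2[OF conjunct2[OF conjunct2[OF usual[unfolded usual_filtration_def]]], rule_format, OF assms]
  by simp_all

lemma F_mono: "0 \<le> s \<Longrightarrow> s \<le> t \<Longrightarrow> F s \<subseteq> F t"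
  using conjunct1[OF conjunct2[OF usual[unfolded usual_filtration_def]], rule_format] .

lemma sets_FM: "0 \<le> t \<Longrightarrow> sets (FM t) = F t"
  unfolding FM_def by (intro sigma_algebra.sets_measure_of_eq sigma_algebra_F)

lemma measurable_FM_mono:
  assumes "f \<in> measurable (FM s) N" "0 \<le> s" "s \<le> t"
  shows "f \<in> measurable (FM t) N"
  using assms F_mono[of s t] sets_FM[of s] sets_FM[of t] by (auto simp: measurable_def)

lemma measurable_FM:
  assumes "f \<in> measurable (FM s) N" "0 \<le> s"
  shows "f \<in> measurable M N"
  using assms F_subset_events[of s] sets_FM[of s] by (auto simp: measurable_def)

lemma adapted_measurable_FM:
  fixes Z :: "real \<Rightarrow> 'a \<Rightarrow> 'b::topological_space"
  assumes "adapted_process M F Z" "0 \<le> t"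
  shows "Z t \<in> borel_measurable (FM t)"
proof (rule measurableI)
  fix B :: "'b set" assume "B \<in> sets borel"
  moreover have "Z t -` B \<inter> space (FM t) = {\<omega>\<in>space M. Z t \<omega> \<in> B}" by auto
  ultimately show "Z t -` B \<inter> space (FM t) \<in> sets (FM t)"
    using assms by (simp add: sets_FM adapted_process_def)
qed simp

lemma W_measurable_FM: "0 \<le> t \<Longrightarrow> W t \<in> borel_measurable (FM t)"
  using adapted_measurable_FM[OF conjunct1[OF brownian[unfolded brownian_motion_def]]] .

lemma W_measurable: "0 \<le> t \<Longrightarrow> W t \<in> borel_measurable M"
  using measurable_FM[OF W_measurable_FM] by simp

lemma
  assumes "0 \<le> s" "s < t"
  shows prob_increment: "A \<in> F s \<Longrightarrow> B \<in> sets borel \<Longrightarrow>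
      prob (A \<inter> {\<omega>\<in>space M. W t \<omega> - W s \<omega> \<in> B}) = prob A * prob {\<omega>\<in>space M. W t \<omega> - W s \<omega> \<in> B}"
    and distr_increment: "distr M borel (\<lambda>\<omega>. W t \<omega> - W s \<omega>)
      = density lborel (\<lambda>v. ennreal (gauss_density (t - s) v))"
  using assms conjunct2[OF conjunct2[OF conjunct2[OF brownian[unfolded brownian_motion_def]]],
      rule_format, of s t] by simp_all

text \<open>The product rule in the definition of Brownian motion concerns single events. Preimages
  of Borel sets are stable under intersection, so the rule passes to the generated sigma-algebras.
  The function \<open>g\<close> is there to extract components of the increment and products of
  components.\<close>

lemma increment_indep:
  assumes st: "0 \<le> s" "s < t"
    and Z: "Z \<in> borel_measurable (FM s)"
    and g: "(g :: real^'m \<Rightarrow> real) \<in> borel_measurable borel"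
  shows "indep_var borel Z borel (\<lambda>\<omega>. g (W t \<omega> - W s \<omega>))"
proof -
  let ?w = "\<lambda>\<omega>. W t \<omega> - W s \<omega>"
  have [measurable]: "W t \<in> borel_measurable M" "W s \<in> borel_measurable M"
    using st by (auto intro: W_measurable)
  have Zm: "Z \<in> borel_measurable M" using measurable_FM[OF Z st(1)] .
  have gm: "(\<lambda>\<omega>. g (?w \<omega>)) \<in> borel_measurable M"
    by (rule measurable_compose[OF _ g]) measurable
  have "indep_set {Z -` A \<inter> space M |A. A \<in> sets borel} {(\<lambda>\<omega>. g (?w \<omega>)) -` A \<inter> space M |A. A \<in> sets borel}"
  proof (rule indep_setI)
    show "{Z -` A \<inter> space M |A. A \<in> sets borel} \<subseteq> events"
      using measurable_sets[OF Zm] by auto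
    show "{(\<lambda>\<omega>. g (?w \<omega>)) -` A \<inter> space M |A. A \<in> sets borel} \<subseteq> events"
      using measurable_sets[OF gm] by auto
    fix a b assume a: "a \<in> {Z -` A \<inter> space M |A. A \<in> sets borel}"
      and "b \<in> {(\<lambda>\<omega>. g (?w \<omega>)) -` A \<inter> space M |A. A \<in> sets borel}"
    then obtain B where B: "b = {\<omega>\<in>space M. ?w \<omega> \<in> g -` B}" "B \<in> sets borel" by auto
    then have "g -` B \<in> sets borel" using measurable_sets[OF g] by simp
    moreover have "a \<in> F s" using a measurable_sets[OF Z] by (auto simp: sets_FM[OF st(1)])
    ultimately show "prob (a \<inter> b) = prob a * prob b"
      unfolding B(1) by (intro prob_increment st)
  qed
  then have "indep_set (sigma_sets (space M) {Z -` A \<inter> space M |A. A \<in> sets borel})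
      (sigma_sets (space M) {(\<lambda>\<omega>. g (?w \<omega>)) -` A \<inter> space M |A. A \<in> sets borel})"
  proof (rule indep_set_sigma_sets)
    have "Int_stable {f -` A \<inter> space M |A. A \<in> sets borel}" for f :: "'a \<Rightarrow> real"
    proof (rule Int_stableI, clarify)
      fix A B :: "real set" assume "A \<in> sets borel" "B \<in> sets borel"
      then show "\<exists>D. f -` A \<inter> space M \<inter> (f -` B \<inter> space M) = f -` D \<inter> space M \<and> D \<in> sets borel"
        by (intro exI[of _ "A \<inter> B"]) auto
    qed
    then show "Int_stable {Z -` A \<inter> space M |A. A \<in> sets borel}"
      "Int_stable {(\<lambda>\<omega>. g (?w \<omega>)) -` A \<inter> space M |A. A \<in> sets borel}"
      by this+
  qed
  then show ?thesis using Zm gm by (simp add: indep_var_eq)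
qed

text \<open>The law of the increment has density \<open>gauss_density (t - s)\<close>, so each
  expectation is a Lebesgue integral computed above.\<close>

lemma
  assumes st: "0 \<le> s" "s < t"
  shows integrable_increment: "integrable M (\<lambda>\<omega>. (W t \<omega> - W s \<omega>) $ i)"
    and expectation_increment: "expectation (\<lambda>\<omega>. (W t \<omega> - W s \<omega>) $ i) = 0"
    and integrable_increment_mult:
      "integrable M (\<lambda>\<omega>. (W t \<omega> - W s \<omega>) $ i * (W t \<omega> - W s \<omega>) $ j)"
    and expectation_increment_mult:
      "expectation (\<lambda>\<omega>. (W t \<omega> - W s \<omega>) $ i * (W t \<omega> - W s \<omega>) $ j) = (if i = j then t - s else 0)"
proof -
  let ?w = "\<lambda>\<omega>. W t \<omega> - W s \<omega>"
  have w: "?w \<in> borel_measurable M" using st by (auto intro!: borel_measurable_diff W_measurable)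
  have d: "distr M borel ?w = density lborel (\<lambda>v. ennreal (gauss_density (t - s) v))"
    by (rule distr_increment[OF st])
  have h: "0 < t - s" using st by simp
  have gm [measurable]: "(\<lambda>v::real^'m. gauss_density (t - s) v) \<in> borel_measurable borel"
    unfolding gauss_density_def by measurable
  have nn: "0 \<le> gauss_density (t - s) (v::real^'m)" for v by (simp add: gauss_density_def)
  have I: "integrable M (\<lambda>\<omega>. g (?w \<omega>)) \<longleftrightarrow> integrable lborel (\<lambda>v. gauss_density (t - s) v * g v)"
    and E: "expectation (\<lambda>\<omega>. g (?w \<omega>)) = (\<integral>v. gauss_density (t - s) v * g v \<partial>lborel)"
    if g [measurable]: "g \<in> borel_measurable borel" for g :: "real^'m \<Rightarrow> real"
  proof -
    show "integrable M (\<lambda>\<omega>. g (?w \<omega>)) \<longleftrightarrow> integrable lborel (\<lambda>v. gauss_density (t - s) v * g v)"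
      unfolding integrable_distr_eq[OF w g, symmetric] d
      by (subst integrable_density) (use nn in auto)
    show "expectation (\<lambda>\<omega>. g (?w \<omega>)) = (\<integral>v. gauss_density (t - s) v * g v \<partial>lborel)"
      unfolding integral_distr[OF w g, symmetric] d
      by (subst integral_density) (use nn in auto)
  qed
  have m: "(\<lambda>v::real^'m. v $ i) \<in> borel_measurable borel"
    "(\<lambda>v::real^'m. v $ i * v $ j) \<in> borel_measurable borel" by measurable
  show "integrable M (\<lambda>\<omega>. ?w \<omega> $ i)" "expectation (\<lambda>\<omega>. ?w \<omega> $ i) = 0"
    unfolding I[OF m(1)] E[OF m(1)]
    by (rule integrable_gauss_density_moment1[OF h] integral_gauss_density_moment1[OF h])+
  show "integrable M (\<lambda>\<omega>. ?w \<omega> $ i * ?w \<omega> $ j)"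
    "expectation (\<lambda>\<omega>. ?w \<omega> $ i * ?w \<omega> $ j) = (if i = j then t - s else 0)"
    unfolding I[OF m(2)] E[OF m(2)]
    by (rule integrable_gauss_density_moment2[OF h] integral_gauss_density_moment2[OF h])+
qed

section \<open>Discrete Ito isometry\<close>

text \<open>After expanding the square, every mixed term is a variable known at time
  \<open>s\<close> times a function of the increment, hence a product of independent factors. The
  terms linear in the increment have mean 0, and among the quadratic ones only \<open>j = l\<close>
  survives. The bound \<open>K\<close> on \<open>g\<close> makes the first factors
  integrable.\<close>

lemma isometry_step:
  fixes P :: "'a \<Rightarrow> real" and g :: "'m \<Rightarrow> 'a \<Rightarrow> real"
  assumes st: "0 \<le> s" "s < t"
    and P: "P \<in> borel_measurable (FM s)" "integrable M (\<lambda>\<omega>. (P \<omega>)\<^sup>2)"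
    and g: "\<And>j. g j \<in> borel_measurable (FM s)" "\<And>j \<omega>. \<omega> \<in> space M \<Longrightarrow> \<bar>g j \<omega>\<bar> \<le> K"
  shows "integrable M (\<lambda>\<omega>. (P \<omega> + (\<Sum>j\<in>UNIV. g j \<omega> * (W t \<omega> - W s \<omega>) $ j))\<^sup>2)" (is ?int)
    and "expectation (\<lambda>\<omega>. (P \<omega> + (\<Sum>j\<in>UNIV. g j \<omega> * (W t \<omega> - W s \<omega>) $ j))\<^sup>2)
      = expectation (\<lambda>\<omega>. (P \<omega>)\<^sup>2) + (t - s) * (\<Sum>j\<in>UNIV. expectation (\<lambda>\<omega>. (g j \<omega>)\<^sup>2))" (is ?eq)
proof -
  let ?w = "\<lambda>\<omega>. W t \<omega> - W s \<omega>"
  have PM [measurable]: "P \<in> borel_measurable M" and gM [measurable]: "g j \<in> borel_measurable M" for j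
    using P(1) g(1) st by (auto intro: measurable_FM)
  have Pi: "integrable M P"
  proof (rule Bochner_Integration.integrable_bound[of M "\<lambda>\<omega>. 1 + (P \<omega>)\<^sup>2"])
    have "\<bar>x\<bar> \<le> 1 + x\<^sup>2" for x :: real
      using zero_le_power2[of "\<bar>x\<bar> - 1"] zero_le_power2[of x] by (simp add: power2_eq_square algebra_simps)
    then show "AE \<omega> in M. norm (P \<omega>) \<le> norm (1 + (P \<omega>)\<^sup>2)"
      by (auto intro!: always_eventually order_trans[OF _ abs_ge_self])
  qed (use P in auto)
  have Pg: "integrable M (\<lambda>\<omega>. P \<omega> * g j \<omega>)" for j
  proof (rule Bochner_Integration.integrable_bound[of M "\<lambda>\<omega>. K * P \<omega>"])
    show "AE \<omega> in M. norm (P \<omega> * g j \<omega>) \<le> norm (K * P \<omega>)"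
    proof (intro AE_I2)
      fix \<omega> assume "\<omega> \<in> space M"
      then have "\<bar>g j \<omega>\<bar> \<le> \<bar>K\<bar>" using g(2)[of \<omega> j] by linarith
      then show "norm (P \<omega> * g j \<omega>) \<le> norm (K * P \<omega>)"
        using mult_right_mono[of "\<bar>g j \<omega>\<bar>" "\<bar>K\<bar>" "\<bar>P \<omega>\<bar>"] by (simp add: abs_mult mult.commute)
    qed
  qed (use Pi in auto)
  have gg: "integrable M (\<lambda>\<omega>. g j \<omega> * g l \<omega>)" for j l
  proof (rule integrable_const_bound[where B = "K * K"])
    show "AE \<omega> in M. norm (g j \<omega> * g l \<omega>) \<le> K * K"
      using g(2) by (intro AE_I2) (auto simp: abs_mult intro!: mult_mono order_trans[OF abs_ge_zero g(2)])
  qed auto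
  have i1: "indep_var borel (\<lambda>\<omega>. P \<omega> * g j \<omega>) borel (\<lambda>\<omega>. ?w \<omega> $ j)" for j
    using st P g by (intro increment_indep[where g = "\<lambda>v. v $ j"]) (auto intro!: borel_measurable_times)
  have i2: "indep_var borel (\<lambda>\<omega>. g j \<omega> * g l \<omega>) borel (\<lambda>\<omega>. ?w \<omega> $ j * ?w \<omega> $ l)" for j l
    using st g by (intro increment_indep[where g = "\<lambda>v. v $ j * v $ l"]) (auto intro!: borel_measurable_times)
  note I1 = indep_var_integrable[OF i1 Pg integrable_increment[OF st]]
  note I2 = indep_var_integrable[OF i2 gg integrable_increment_mult[OF st]]
  have E1: "expectation (\<lambda>\<omega>. P \<omega> * g j \<omega> * ?w \<omega> $ j) = 0" for j
    using indep_var_lebesgue_integral[OF i1 Pg integrable_increment[OF st]] expectation_increment[OF st]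
    by simp
  have E2: "expectation (\<lambda>\<omega>. g j \<omega> * g l \<omega> * (?w \<omega> $ j * ?w \<omega> $ l))
      = (if j = l then (t - s) * expectation (\<lambda>\<omega>. (g j \<omega>)\<^sup>2) else 0)" for j l
    using indep_var_lebesgue_integral[OF i2 gg integrable_increment_mult[OF st]]
      expectation_increment_mult[OF st]
    by (simp add: power2_eq_square)
  have expand: "(P \<omega> + (\<Sum>j\<in>UNIV. g j \<omega> * ?w \<omega> $ j))\<^sup>2 = (P \<omega>)\<^sup>2
      + (\<Sum>j\<in>UNIV. 2 * (P \<omega> * g j \<omega> * ?w \<omega> $ j))
      + (\<Sum>j\<in>UNIV. \<Sum>l\<in>UNIV. g j \<omega> * g l \<omega> * (?w \<omega> $ j * ?w \<omega> $ l))" for \<omega>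
    by (simp add: power2_sum power2_eq_square sum_product sum_distrib_left algebra_simps)
  show ?int unfolding expand using P I1 I2 by auto
  show ?eq unfolding expand using P I1 I2 by (simp add: E1 E2 sum_distrib_left del: vector_minus_component)
qed

text \<open>For each row \<open>i\<close>, the next summand adds to \<open>S m \<omega> $ i\<close>
  a combination of increments whose coefficients are bounded and known at time
  \<open>\<tau> m\<close>. Induction with \<open>isometry_step\<close>, taking \<open>P\<close> as
  the component reached so far, gives the formula per row, and summing over rows restores the
  norms.\<close>

lemma
  fixes H :: "nat \<Rightarrow> 'a \<Rightarrow> real^'m^'d" and \<tau> :: "nat \<Rightarrow> real"
  assumes \<tau>: "0 \<le> \<tau> 0" "strict_mono \<tau>"
    and H: "\<And>k. H k \<in> borel_measurable (FM (\<tau> k))" "\<And>k \<omega>. \<omega> \<in> space M \<Longrightarrow> norm (H k \<omega>) \<le> K"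
  defines "S m \<omega> \<equiv> \<Sum>k<m. H k \<omega> *v (W (\<tau> (Suc k)) \<omega> - W (\<tau> k) \<omega>)"
  shows integrable_discrete_ito: "integrable M (\<lambda>\<omega>. (norm (S m \<omega>))\<^sup>2)"
    and discrete_ito_isometry: "expectation (\<lambda>\<omega>. (norm (S m \<omega>))\<^sup>2)
      = (\<Sum>k<m. (\<tau> (Suc k) - \<tau> k) * expectation (\<lambda>\<omega>. (norm (H k \<omega>))\<^sup>2))"
proof -
  have pos: "0 \<le> \<tau> k" for k
    using \<tau> by (metis order_trans strict_mono_less_eq zero_le)
  have lt: "\<tau> k < \<tau> (Suc k)" for k using \<tau>(2) by (simp add: strict_mono_less)
  have norm2: "(norm v)\<^sup>2 = (\<Sum>i\<in>UNIV. (v $ i)\<^sup>2)" for v :: "real^'d"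
    by (simp add: norm_vec_def L2_set_def sum_nonneg)
  \<comment> \<open>The norm of the nested vector type is the Hilbert-Schmidt norm, the one in which
    the modulus of \<open>\<sigma>\<close> is stated.\<close>
  have normH: "(norm A)\<^sup>2 = (\<Sum>i\<in>UNIV. \<Sum>j\<in>UNIV. (A $ i $ j)\<^sup>2)" for A :: "real^'m^'d"
    by (simp add: norm_vec_def L2_set_def sum_nonneg)
  have Hc: "(\<lambda>\<omega>. H k \<omega> $ i $ j) \<in> borel_measurable (FM (\<tau> k))" for k i j
  proof -
    have "(\<lambda>A::real^'m^'d. A $ i $ j) \<in> borel_measurable borel"
      by (intro borel_measurable_continuous_onI continuous_intros)
    from measurable_compose[OF H(1) this] show ?thesis by simp
  qed
  have Hb: "\<omega> \<in> space M \<Longrightarrow> \<bar>H k \<omega> $ i $ j\<bar> \<le> K" for k i j \<omega>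
    by (rule order_trans[OF component_le_norm_cart order_trans[OF Finite_Cartesian_Product.norm_nth_le H(2)]])
  have HcM: "(\<lambda>\<omega>. H k \<omega> $ i $ j) \<in> borel_measurable M" for k i j
    using measurable_FM[OF Hc pos] .
  have Hi: "integrable M (\<lambda>\<omega>. (H k \<omega> $ i $ j)\<^sup>2)" for k i j
  proof (rule integrable_const_bound[where B = "K\<^sup>2"])
    show "AE \<omega> in M. norm ((H k \<omega> $ i $ j)\<^sup>2) \<le> K\<^sup>2"
      using Hb[of _ k i j] by (intro AE_I2) (auto simp: abs_le_square_iff[symmetric] intro!: order_trans[OF _ abs_ge_self])
  qed (use HcM in simp)
  have Ssuc: "S (Suc m) \<omega> $ i = S m \<omega> $ i
      + (\<Sum>j\<in>UNIV. H m \<omega> $ i $ j * (W (\<tau> (Suc m)) \<omega> - W (\<tau> m) \<omega>) $ j)" for m \<omega> i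
    by (simp add: S_def matrix_vector_mult_def)
  have meas: "(\<lambda>\<omega>. S m \<omega> $ i) \<in> borel_measurable (FM (\<tau> m))" for m i
  proof (induction m)
    case (Suc m)
    have [measurable]: "(\<lambda>\<omega>. S m \<omega> $ i) \<in> borel_measurable (FM (\<tau> (Suc m)))"
      "\<And>i j. (\<lambda>\<omega>. H m \<omega> $ i $ j) \<in> borel_measurable (FM (\<tau> (Suc m)))"
      "W (\<tau> m) \<in> borel_measurable (FM (\<tau> (Suc m)))"
      "W (\<tau> (Suc m)) \<in> borel_measurable (FM (\<tau> (Suc m)))"
      by (rule measurable_FM_mono[OF Suc pos less_imp_le[OF lt]] measurable_FM_mono[OF Hc pos less_imp_le[OF lt]]
          measurable_FM_mono[OF W_measurable_FM[OF pos] pos less_imp_le[OF lt]] W_measurable_FM[OF pos])+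
    have [measurable]: "(\<lambda>\<omega>. (W (\<tau> (Suc m)) \<omega> - W (\<tau> m) \<omega>) $ j) \<in> borel_measurable (FM (\<tau> (Suc m)))" for j
      by (rule borel_measurable_vec_component) measurable
    show ?case unfolding Ssuc by measurable
  qed (simp add: S_def)
  have step: "integrable M (\<lambda>\<omega>. (S m \<omega> $ i)\<^sup>2) \<and> expectation (\<lambda>\<omega>. (S m \<omega> $ i)\<^sup>2)
      = (\<Sum>k<m. (\<tau> (Suc k) - \<tau> k) * (\<Sum>j\<in>UNIV. expectation (\<lambda>\<omega>. (H k \<omega> $ i $ j)\<^sup>2)))" for m i
  proof (induction m)
    case (Suc m)
    note * = isometry_step[OF pos[of m] lt[of m] meas[of m i], of "\<lambda>j \<omega>. H m \<omega> $ i $ j" K]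
    show ?case unfolding Ssuc using Suc * Hc Hb by simp
  qed (simp add: S_def)
  show "integrable M (\<lambda>\<omega>. (norm (S m \<omega>))\<^sup>2)"
    unfolding norm2 using step by auto
  have "expectation (\<lambda>\<omega>. (norm (S m \<omega>))\<^sup>2)
      = (\<Sum>i\<in>UNIV. \<Sum>k<m. (\<tau> (Suc k) - \<tau> k) * (\<Sum>j\<in>UNIV. expectation (\<lambda>\<omega>. (H k \<omega> $ i $ j)\<^sup>2)))"
    unfolding norm2 using step by simp
  also have "\<dots> = (\<Sum>k<m. (\<tau> (Suc k) - \<tau> k) * expectation (\<lambda>\<omega>. (norm (H k \<omega>))\<^sup>2))"
    unfolding normH using Hi by (subst sum.swap) (simp add: sum_distrib_left)
  finally show "expectation (\<lambda>\<omega>. (norm (S m \<omega>))\<^sup>2)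
      = (\<Sum>k<m. (\<tau> (Suc k) - \<tau> k) * expectation (\<lambda>\<omega>. (norm (H k \<omega>))\<^sup>2))" .
qed

text \<open>The condition ranges over uncountably many times. Its restriction \<open>?Q\<close> to
  rational times and \<open>t\<close> is measurable, and it differs from \<open>?B\<close> only at
  discontinuous paths. Completeness makes that difference an event, and as a null set it belongs to
  \<open>F t\<close>.\<close>

lemma bounded_path_event_in_F:
  fixes Z :: "real \<Rightarrow> 'a \<Rightarrow> real^'d"
  assumes Z: "adapted_process M F Z" and cont: "AE \<omega> in M. continuous_on {0..} (\<lambda>t. Z t \<omega>)"
    and t: "0 \<le> t"
  shows "{\<omega>\<in>space M. \<forall>r\<in>{0..t}. norm (Z r \<omega>) \<le> R} \<in> F t"
proof -
  let ?B = "{\<omega>\<in>space M. \<forall>r\<in>{0..t}. norm (Z r \<omega>) \<le> R}"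
  let ?Q = "{\<omega>\<in>space M. \<forall>r\<in>insert t (\<rat> \<inter> {0..t}). norm (Z r \<omega>) \<le> R}"
  have "{\<omega>\<in>space (FM t). norm (Z r \<omega>) \<le> R} \<in> sets (FM t)" if "0 \<le> r" "r \<le> t" for r
  proof -
    have [measurable]: "Z r \<in> borel_measurable (FM t)"
      by (rule measurable_FM_mono[OF adapted_measurable_FM[OF Z that(1)] that])
    show ?thesis by measurable
  qed
  then have "{\<omega>\<in>space (FM t). \<forall>r\<in>insert t (\<rat> \<inter> {0..t}). norm (Z r \<omega>) \<le> R} \<in> sets (FM t)"
  proof (rule sets.sets_Collect_countable_All')
    show "countable (insert t (\<rat> \<inter> {0..t}))"
      by (intro countable_insert countable_Int1 countable_rat)
  qed (use t in auto)
  then have Q: "?Q \<in> sets (FM t)" by simp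
  from cont obtain N where N: "\<And>\<omega>. \<omega> \<in> space M - N \<Longrightarrow> continuous_on {0..} (\<lambda>t. Z t \<omega>)"
      "N \<in> null_sets M"
    by (rule AE_E3) blast
  have sub: "?Q - ?B \<subseteq> N"
  proof
    fix \<omega> assume \<omega>: "\<omega> \<in> ?Q - ?B"
    have "\<not> continuous_on {0..} (\<lambda>t. Z t \<omega>)"
    proof
      assume "continuous_on {0..} (\<lambda>t. Z t \<omega>)"
      then have "continuous_on {0..t} (\<lambda>t. Z t \<omega>)" by (rule continuous_on_subset) auto
      then have "norm (Z r \<omega>) \<le> R" if "r \<in> {0..t}" for r
        by (rule norm_le_if_norm_le_on_rationals[OF _ _ that]) (use \<omega> in auto)
      with \<omega> show False by auto
    qed
    with \<omega> N show "\<omega> \<in> N" by auto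
  qed
  have "?Q - ?B \<in> sets M"
    by (rule complete[unfolded complete_measure_space_def, rule_format, OF N(2) sub])
  then have "?Q - ?B \<in> null_sets M" by (rule null_sets_subset[OF N(2) _ sub])
  then have D: "?Q - ?B \<in> sets (FM t)"
    unfolding sets_FM[OF t] by (rule subsetD[OF null_sets_subset_F[OF t]])
  have "?B \<subseteq> ?Q" using t by auto
  then have "?B = ?Q - (?Q - ?B)" by blast
  moreover have "?Q - (?Q - ?B) \<in> sets (FM t)" by (rule sets.Diff[OF Q D])
  ultimately show ?thesis unfolding sets_FM[OF t] by (simp only:)
qed

end

subsection \<open>Logarithmic Gronwall argument\<close>

lemma ln_squared_powr_tendsto_0:
  assumes "0 < (a::real)"
  shows "(\<lambda>N::nat. (ln (real N))\<^sup>2 * real N powr (- a)) \<longlonglongrightarrow> 0"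
  using assms by real_asymp

text \<open>For \<open>l = K * ln N\<close> the estimate bounds the weighted supremum
  \<open>v\<close> by \<open>v / 2\<close> plus the error, so \<open>v\<close> is at most twice the
  error. Undoing the weight at \<open>t1\<close> costs at most \<open>N powr \<mu>\<close>, and the
  bound for \<open>\<phi> t1\<close> that remains tends to 0 as \<open>N\<close> grows.\<close>

lemma log_gronwall_step:
  fixes \<phi> :: "real \<Rightarrow> real" and C K B c \<mu> s0 t1 :: real
  assumes C: "0 < C" and K: "1 \<le> K" "12 * C\<^sup>2 \<le> K" and \<mu>: "0 < \<mu>"
    and nn: "\<And>s. 0 \<le> s \<Longrightarrow> 0 \<le> \<phi> s" and B: "\<And>s. 0 \<le> s \<Longrightarrow> \<phi> s \<le> B"
    and c: "0 \<le> c"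
    and est: "\<And>(N::nat) l v t. N0 \<le> N \<Longrightarrow> 0 < l \<Longrightarrow> 0 \<le> v \<Longrightarrow> 0 \<le> t \<Longrightarrow> t \<le> t1 \<Longrightarrow>
      (\<And>s. 0 \<le> s \<Longrightarrow> s \<le> t \<Longrightarrow> \<phi> s \<le> v * exp (2 * l * (s - s0))) \<Longrightarrow>
      \<phi> t \<le> (3 * C\<^sup>2 * (ln (real N))\<^sup>2 / l\<^sup>2 + 3 * C\<^sup>2 * ln (real N) / l) * (v * exp (2 * l * (t - s0)))
        + c * (C * ln (real N) / real N powr \<mu>)\<^sup>2"
    and zero: "\<And>s. 0 \<le> s \<Longrightarrow> s \<le> s0 \<Longrightarrow> \<phi> s = 0"
    and t1: "0 \<le> s0" "s0 \<le> t1" "t1 - s0 \<le> \<mu> / (2 * K)"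
  shows "\<phi> t1 = 0"
proof -
  have bound: "\<phi> t1 \<le> 2 * c * C\<^sup>2 * ((ln (real N))\<^sup>2 * real N powr (- \<mu>))" if N: "max N0 3 \<le> N" for N :: nat
  proof -
    define L where "L = ln (real N)"
    define \<epsilon> where "\<epsilon> = C * L / real N powr \<mu>"
    \<comment> \<open>The weight is normalized to 1 at \<open>s0\<close>. Boundedness of \<phi>
      makes this supremum finite, which is essential for subtracting \<open>v / 2\<close>
      later.\<close>
    define v where "v = (SUP s\<in>{0..t1}. \<phi> s * exp (- (2 * (K * L) * (s - s0))))"
    have N3: "3 \<le> real N" using N by simp
    have L: "0 < L" using N3 by (simp add: L_def)
    have KL: "0 < K * L" using K L by simp
    have bdd: "bdd_above ((\<lambda>s. \<phi> s * exp (- (2 * (K * L) * (s - s0)))) ` {0..t1})"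
    proof (rule bdd_aboveI2)
      fix s assume s: "s \<in> {0..t1}"
      have "0 \<le> K * L * s" using KL s by simp
      then have "- (2 * (K * L) * (s - s0)) \<le> 2 * (K * L) * s0" by (simp add: algebra_simps)
      then show "\<phi> s * exp (- (2 * (K * L) * (s - s0))) \<le> B * exp (2 * (K * L) * s0)"
        using nn[of s] B[of s] s by (intro mult_mono) auto
    qed
    have le_v: "\<phi> s * exp (- (2 * (K * L) * (s - s0))) \<le> v" if "0 \<le> s" "s \<le> t1" for s
      unfolding v_def using that by (intro cSUP_upper[OF _ bdd]) auto
    have \<phi>v: "\<phi> s \<le> v * exp (2 * (K * L) * (s - s0))" if "0 \<le> s" "s \<le> t1" for s
      using mult_right_mono[OF le_v[OF that], of "exp (2 * (K * L) * (s - s0))"]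
      by (simp add: mult.assoc exp_add[symmetric])
    have v0: "0 \<le> v"
      using le_v[of 0] nn[of 0] t1 by (metis exp_ge_zero mult_nonneg_nonneg order_refl order_trans)
    \<comment> \<open>The logarithms cancel, leaving \<open>3 * C^2 / K^2 + 3 * C^2 / K\<close>.
      From \<open>1 \<le> K\<close> the first term is at most the second, and
      \<open>12 * C^2 \<le> K\<close> makes the second at most \<open>1 / 4\<close>.\<close>
    have half: "3 * C\<^sup>2 * L\<^sup>2 / (K * L)\<^sup>2 + 3 * C\<^sup>2 * L / (K * L) \<le> 1 / 2"
    proof -
      have eq: "3 * C\<^sup>2 * L\<^sup>2 / (K * L)\<^sup>2 = 3 * C\<^sup>2 / K\<^sup>2" "3 * C\<^sup>2 * L / (K * L) = 3 * C\<^sup>2 / K"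
        using L K by (simp_all add: power_mult_distrib)
      have "3 * C\<^sup>2 / K\<^sup>2 \<le> 3 * C\<^sup>2 / K"
        using K by (intro divide_left_mono) (auto simp: power2_eq_square)
      moreover have le: "3 * C\<^sup>2 / K \<le> 1 / 4" using K by (simp add: divide_le_eq)
      ultimately have "3 * C\<^sup>2 / K\<^sup>2 \<le> 1 / 4" by (rule order_trans)
      from add_mono[OF this le] show ?thesis unfolding eq by simp
    qed
    have step: "\<phi> s * exp (- (2 * (K * L) * (s - s0))) \<le> v / 2 + c * \<epsilon>\<^sup>2" if s: "s \<in> {0..t1}" for s
    proof (cases "s \<le> s0")
      case True
      then show ?thesis using zero[of s] s v0 c by simp
    next
      case False
      let ?E = "exp (2 * (K * L) * (s - s0))"
      have "\<phi> s \<le> (3 * C\<^sup>2 * L\<^sup>2 / (K * L)\<^sup>2 + 3 * C\<^sup>2 * L / (K * L)) * (v * ?E) + c * \<epsilon>\<^sup>2"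
        unfolding L_def \<epsilon>_def
        by (rule est) (use N KL v0 s \<phi>v in \<open>auto simp: L_def\<close>)
      \<comment> \<open>Beyond \<open>s0\<close> the factor \<open>?E\<close> is at least 1, so the
        error may be multiplied by it and survives the division by \<open>?E\<close>. Before
        \<open>s0\<close> this would fail, but there \<phi> vanishes.\<close>
      also have "\<dots> \<le> 1 / 2 * (v * ?E) + c * \<epsilon>\<^sup>2 * ?E"
      proof (intro add_mono mult_right_mono half)
        have "1 \<le> ?E" using KL False by simp
        then show "c * \<epsilon>\<^sup>2 \<le> c * \<epsilon>\<^sup>2 * ?E" using c mult_left_mono[of 1 ?E "c * \<epsilon>\<^sup>2"] by simp
      qed (use v0 in simp)
      also have "\<dots> = (v / 2 + c * \<epsilon>\<^sup>2) * ?E" by (simp add: algebra_simps)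
      finally have "\<phi> s * exp (- (2 * (K * L) * (s - s0))) \<le> (v / 2 + c * \<epsilon>\<^sup>2) * ?E * exp (- (2 * (K * L) * (s - s0)))"
        by (rule mult_right_mono) simp
      then show ?thesis by (simp add: mult.assoc exp_add[symmetric])
    qed
    have "v \<le> v / 2 + c * \<epsilon>\<^sup>2"
      unfolding v_def by (rule cSUP_least) (use t1 step in \<open>auto simp: v_def[symmetric]\<close>)
    then have v: "v \<le> 2 * c * \<epsilon>\<^sup>2" by simp
    \<comment> \<open>The restriction on the step length enters here: the exponent is at most
      \<open>\<mu> * ln N\<close>.\<close>
    have "2 * (K * L) * (t1 - s0) \<le> 2 * (K * L) * (\<mu> / (2 * K))"
      using t1 KL by (intro mult_left_mono) auto
    also have "\<dots> = \<mu> * L" using K by simp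
    finally have E: "exp (2 * (K * L) * (t1 - s0)) \<le> real N powr \<mu>"
      using N3 by (simp add: powr_def L_def)
    have "\<phi> t1 \<le> v * exp (2 * (K * L) * (t1 - s0))" using \<phi>v[of t1] t1 by simp
    also have "\<dots> \<le> 2 * c * \<epsilon>\<^sup>2 * real N powr \<mu>"
      using v E c by (intro mult_mono) auto
    also have "\<dots> = 2 * c * C\<^sup>2 * (L\<^sup>2 * real N powr (- \<mu>))"
      using N3 by (simp add: \<epsilon>_def power2_eq_square powr_minus field_simps)
    finally show ?thesis by (simp add: L_def)
  qed
  have "(\<lambda>N. 2 * c * C\<^sup>2 * ((ln (real N))\<^sup>2 * real N powr (- \<mu>))) \<longlonglongrightarrow> 2 * c * C\<^sup>2 * 0"
    by (intro tendsto_mult tendsto_const ln_squared_powr_tendsto_0 \<mu>)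
  then have "\<phi> t1 \<le> 2 * c * C\<^sup>2 * 0"
    by (rule LIMSEQ_le_const) (use bound in blast)
  then show ?thesis using nn[of t1] t1 by simp
qed

text \<open>The length \<open>\<delta>\<close> is determined by \<open>C\<close> and
  \<open>\<mu>\<close> alone, so repeated steps do not shrink and finitely many cover
  \<open>[0, t]\<close>. The estimate is assumed for every centre \<open>s0\<close> because each
  step centres its weight at the end of the interval already settled.\<close>

lemma log_gronwall:
  fixes \<phi> :: "real \<Rightarrow> real" and C B c \<mu> T :: real
  assumes C: "0 < C" and \<mu>: "0 < \<mu>"
    and nn: "\<And>s. 0 \<le> s \<Longrightarrow> 0 \<le> \<phi> s" and B: "\<And>s. 0 \<le> s \<Longrightarrow> \<phi> s \<le> B"
    and c: "0 \<le> c"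
    and est: "\<And>(N::nat) l v s0 t. N0 \<le> N \<Longrightarrow> 0 < l \<Longrightarrow> 0 \<le> v \<Longrightarrow> 0 \<le> t \<Longrightarrow> t \<le> T \<Longrightarrow>
      (\<And>s. 0 \<le> s \<Longrightarrow> s \<le> t \<Longrightarrow> \<phi> s \<le> v * exp (2 * l * (s - s0))) \<Longrightarrow>
      \<phi> t \<le> (3 * C\<^sup>2 * (ln (real N))\<^sup>2 / l\<^sup>2 + 3 * C\<^sup>2 * ln (real N) / l) * (v * exp (2 * l * (t - s0)))
        + c * (C * ln (real N) / real N powr \<mu>)\<^sup>2"
    and zero: "\<phi> 0 = 0" and t: "0 \<le> t" "t \<le> T"
  shows "\<phi> t = 0"
proof -
  define K where "K = max 1 (12 * C\<^sup>2)"
  define \<delta> where "\<delta> = \<mu> / (2 * K)"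
  have K: "1 \<le> K" "12 * C\<^sup>2 \<le> K" by (simp_all add: K_def)
  have \<delta>: "0 < \<delta>" using \<mu> K by (simp add: \<delta>_def)
  have all: "\<forall>s. 0 \<le> s \<longrightarrow> s \<le> T \<longrightarrow> s \<le> real n * \<delta> \<longrightarrow> \<phi> s = 0" for n
  proof (induction n)
    case 0
    then show ?case using zero by auto
  next
    case (Suc n)
    show ?case
    proof (intro allI impI)
      fix s assume s: "0 \<le> s" "s \<le> T" "s \<le> real (Suc n) * \<delta>"
      show "\<phi> s = 0"
      proof (cases "s \<le> real n * \<delta>")
        case True
        then show ?thesis using Suc s by blast
      next
        case False
        show ?thesis
        proof (rule log_gronwall_step[OF C K \<mu> nn B c, where ?N0.0 = N0 and ?s0.0 = "real n * \<delta>"])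
          show "\<phi> r = 0" if "0 \<le> r" "r \<le> real n * \<delta>" for r
            using Suc s that False by auto
          show "s - real n * \<delta> \<le> \<mu> / (2 * K)" unfolding \<delta>_def[symmetric] using s by (simp add: algebra_simps)
        qed (use est s False \<delta> in auto)
      qed
    qed
  qed
  obtain n :: nat where "t / \<delta> \<le> real n" using real_arch_simple by blast
  then have "t \<le> real n * \<delta>" using \<delta> by (simp add: divide_le_eq)
  then show ?thesis using all t by blast
qed

subsection \<open>Two solutions\<close>

locale sde_pair = brownian_space M F W
  for M :: "'a measure" and F and W :: "real \<Rightarrow> 'a \<Rightarrow> real^'m" +
  fixes \<sigma> :: "real^'d \<Rightarrow> real^'m^'d" and b :: "real^'d \<Rightarrow> real^'d"
    and x :: "real^'d" and X Y :: "real \<Rightarrow> 'a \<Rightarrow> real^'d" and C \<mu> :: real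
  assumes \<sigma>_cont: "continuous_on UNIV \<sigma>" and b_cont: "continuous_on UNIV b"
    and C_pos: "C > 0" and \<mu>_pos: "\<mu> > 0"
    and \<sigma>_modulus: "\<And>(N::nat) y z. real N > exp 1 \<Longrightarrow> norm y \<le> real N \<Longrightarrow> norm z \<le> real N \<Longrightarrow>
      norm (\<sigma> y - \<sigma> z) \<le> C * sqrt (ln (real N)) * norm (y - z) + C * ln (real N) / real N powr \<mu>"
    and b_modulus: "\<And>(N::nat) y z. real N > exp 1 \<Longrightarrow> norm y \<le> real N \<Longrightarrow> norm z \<le> real N \<Longrightarrow>
      norm (b y - b z) \<le> C * ln (real N) * norm (y - z) + C * ln (real N) / real N powr \<mu>"
    and X_sol: "sde_solution M F W \<sigma> b x X" and Y_sol: "sde_solution M F W \<sigma> b x Y"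
begin

text \<open>The two path conditions are kept apart so that \<open>bounded_path_event_in_F\<close>
  applies to each process separately.\<close>

definition good :: "real \<Rightarrow> real \<Rightarrow> 'a set" where
  "good R t = {\<omega>\<in>space M. \<forall>r\<in>{0..t}. norm (X r \<omega>) \<le> R} \<inter> {\<omega>\<in>space M. \<forall>r\<in>{0..t}. norm (Y r \<omega>) \<le> R}"

definition deviation :: "real \<Rightarrow> real \<Rightarrow> real" where
  "deviation R t = expectation (\<lambda>\<omega>. indicat_real (good R t) \<omega> * (norm (X t \<omega> - Y t \<omega>))\<^sup>2)"

definition drift_sum :: "real \<Rightarrow> real \<Rightarrow> nat \<Rightarrow> 'a \<Rightarrow> real^'d" where
  "drift_sum R t n \<omega> = (\<Sum>k<2^n. (t / 2^n) *\<^sub>R (indicat_real (good R (t * real k / 2^n)) \<omega> *\<^sub>R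
     (b (X (t * real k / 2^n) \<omega>) - b (Y (t * real k / 2^n) \<omega>))))"

text \<open>The indicator refers to the left end of each cell. Thus the coefficient of an increment
  is bounded and known when the increment starts, as the discrete isometry demands.\<close>

definition noise_sum :: "real \<Rightarrow> real \<Rightarrow> nat \<Rightarrow> 'a \<Rightarrow> real^'d" where
  "noise_sum R t n \<omega> = (\<Sum>k<2^n. (indicat_real (good R (t * real k / 2^n)) \<omega> *\<^sub>R
     (\<sigma> (X (t * real k / 2^n) \<omega>) - \<sigma> (Y (t * real k / 2^n) \<omega>))) *v
     (W (t * real (Suc k) / 2^n) \<omega> - W (t * real k / 2^n) \<omega>))"

lemma X_adapted: "adapted_process M F X" and Y_adapted: "adapted_process M F Y"
  and X_paths: "AE \<omega> in M. continuous_on {0..} (\<lambda>t. X t \<omega>)"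
  and Y_paths: "AE \<omega> in M. continuous_on {0..} (\<lambda>t. Y t \<omega>)"
  using X_sol Y_sol by (simp_all only: sde_solution_def)

lemma X_measurable_FM: "0 \<le> t \<Longrightarrow> X t \<in> borel_measurable (FM t)"
  and Y_measurable_FM: "0 \<le> t \<Longrightarrow> Y t \<in> borel_measurable (FM t)"
  by (rule adapted_measurable_FM[OF X_adapted] adapted_measurable_FM[OF Y_adapted]; assumption)+

lemma good_FM: "0 \<le> t \<Longrightarrow> good R t \<in> sets (FM t)"
  unfolding good_def by (rule sets.Int)
    (simp_all only: sets_FM bounded_path_event_in_F[OF X_adapted X_paths] bounded_path_event_in_F[OF Y_adapted Y_paths])

lemma good_events: "0 \<le> t \<Longrightarrow> good R t \<in> events"
  using F_subset_events[of t] good_FM[of t R] by (auto simp: sets_FM)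

lemma good_antimono: "s \<le> t \<Longrightarrow> good R t \<subseteq> good R s"
  unfolding good_def by auto

lemma good_norm_le:
  assumes "\<omega> \<in> good R t" "0 \<le> t"
  shows "norm (X t \<omega>) \<le> R" "norm (Y t \<omega>) \<le> R"
  using assms unfolding good_def by auto

lemma coefficient_measurable:
  assumes "0 \<le> t"
  shows "(\<lambda>\<omega>. \<sigma> (X t \<omega>)) \<in> borel_measurable (FM t)" "(\<lambda>\<omega>. \<sigma> (Y t \<omega>)) \<in> borel_measurable (FM t)"
    "(\<lambda>\<omega>. b (X t \<omega>)) \<in> borel_measurable (FM t)" "(\<lambda>\<omega>. b (Y t \<omega>)) \<in> borel_measurable (FM t)"
  by (rule measurable_compose[OF X_measurable_FM[OF assms] borel_measurable_continuous_onI[OF \<sigma>_cont]]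
    measurable_compose[OF Y_measurable_FM[OF assms] borel_measurable_continuous_onI[OF \<sigma>_cont]]
    measurable_compose[OF X_measurable_FM[OF assms] borel_measurable_continuous_onI[OF b_cont]]
    measurable_compose[OF Y_measurable_FM[OF assms] borel_measurable_continuous_onI[OF b_cont]])+

lemma
  assumes t: "0 \<le> t"
  shows integrable_deviation: "integrable M (\<lambda>\<omega>. indicat_real (good R t) \<omega> * (norm (X t \<omega> - Y t \<omega>))\<^sup>2)"
    and deviation_le_bound: "deviation R t \<le> (2 * \<bar>R\<bar>)\<^sup>2" and deviation_nonneg: "0 \<le> deviation R t"
proof -
  have [measurable]: "X t \<in> borel_measurable M" "Y t \<in> borel_measurable M" "good R t \<in> events"
    using measurable_FM[OF X_measurable_FM[OF t] t] measurable_FM[OF Y_measurable_FM[OF t] t] good_events[OF t] by auto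
  have le: "indicat_real (good R t) \<omega> * (norm (X t \<omega> - Y t \<omega>))\<^sup>2 \<le> (2 * \<bar>R\<bar>)\<^sup>2" for \<omega>
  proof (cases "\<omega> \<in> good R t")
    case True
    have "norm (X t \<omega> - Y t \<omega>) \<le> 2 * \<bar>R\<bar>"
      using norm_triangle_ineq4[of "X t \<omega>" "Y t \<omega>"] good_norm_le[OF True t] by linarith
    then have "(norm (X t \<omega> - Y t \<omega>))\<^sup>2 \<le> (2 * \<bar>R\<bar>)\<^sup>2" by (rule power_mono) simp
    then show ?thesis by (simp only: indicator_simps(1)[OF True] mult_1)
  qed simp
  show int: "integrable M (\<lambda>\<omega>. indicat_real (good R t) \<omega> * (norm (X t \<omega> - Y t \<omega>))\<^sup>2)"
    by (rule integrable_const_bound[where B = "(2 * \<bar>R\<bar>)\<^sup>2"]) (use le in \<open>auto simp: abs_mult\<close>)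
  have "deviation R t \<le> expectation (\<lambda>_. (2 * \<bar>R\<bar>)\<^sup>2)"
    unfolding deviation_def by (rule integral_mono[OF int integrable_const le])
  then show "deviation R t \<le> (2 * \<bar>R\<bar>)\<^sup>2" by (simp add: prob_space)
  show "0 \<le> deviation R t" unfolding deviation_def by (intro Bochner_Integration.integral_nonneg) auto
qed

section \<open>Localized Riemann sums and their limits\<close>

lemma ito_riemann_sum_measurable:
  assumes "0 \<le> t" "\<And>s. 0 \<le> s \<Longrightarrow> H s \<in> borel_measurable M"
  shows "ito_riemann_sum H W t n \<in> borel_measurable M"
  unfolding ito_riemann_sum_def
  by (intro borel_measurable_sum borel_measurable_matrix_vector_mult borel_measurable_diff W_measurable assms)
     (use assms(1) in simp_all)

text \<open>On \<open>good R t\<close> all earlier indicators equal 1, so the localized sums are the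
  differences of the original sums for \<open>X\<close> and \<open>Y\<close>. A subsequence
  \<open>p\<close> handles the Ito sums of \<open>X\<close>, a further one \<open>q\<close> those of
  \<open>Y\<close>, and the drift sums converge along any subsequence.\<close>

lemma stopped_sums_tendsto:
  assumes t: "0 \<le> t"
  obtains r :: "nat \<Rightarrow> nat" where
    "AE \<omega> in M. \<omega> \<in> good R t \<longrightarrow> (\<lambda>n. drift_sum R t (r n) \<omega> + noise_sum R t (r n) \<omega>) \<longlonglongrightarrow> X t \<omega> - Y t \<omega>"
proof -
  have "\<exists>I. is_ito_integral M W (\<lambda>s \<omega>. \<sigma> (X s \<omega>)) t I \<and>
        (AE \<omega> in M. X t \<omega> = x + integral {0..t} (\<lambda>s. b (X s \<omega>)) + I \<omega>)"
    and "\<exists>I. is_ito_integral M W (\<lambda>s \<omega>. \<sigma> (Y s \<omega>)) t I \<and>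
        (AE \<omega> in M. Y t \<omega> = x + integral {0..t} (\<lambda>s. b (Y s \<omega>)) + I \<omega>)"
    using X_sol Y_sol t unfolding sde_solution_def by simp_all
  then obtain IX IY where IX: "is_ito_integral M W (\<lambda>s \<omega>. \<sigma> (X s \<omega>)) t IX"
    and eqX: "AE \<omega> in M. X t \<omega> = x + integral {0..t} (\<lambda>s. b (X s \<omega>)) + IX \<omega>"
    and IY: "is_ito_integral M W (\<lambda>s \<omega>. \<sigma> (Y s \<omega>)) t IY"
    and eqY: "AE \<omega> in M. Y t \<omega> = x + integral {0..t} (\<lambda>s. b (Y s \<omega>)) + IY \<omega>"
    by (elim exE conjE) (rule that)
  let ?S = "\<lambda>Z n \<omega>. ito_riemann_sum (\<lambda>s \<omega>. \<sigma> (Z s \<omega>)) W t n \<omega>"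
  have mX: "?S X n \<in> borel_measurable M" and mY: "?S Y n \<in> borel_measurable M" for n
    by (intro ito_riemann_sum_measurable t measurable_FM[OF coefficient_measurable(1)] measurable_FM[OF coefficient_measurable(2)]; assumption)+
  have IXm: "IX \<in> borel_measurable M" and IYm: "IY \<in> borel_measurable M"
    and limX: "\<And>e. 0 < e \<Longrightarrow> (\<lambda>n. prob {\<omega>\<in>space M. norm (?S X n \<omega> - IX \<omega>) > e}) \<longlonglongrightarrow> 0"
    and limY: "\<And>e. 0 < e \<Longrightarrow> (\<lambda>n. prob {\<omega>\<in>space M. norm (?S Y n \<omega> - IY \<omega>) > e}) \<longlonglongrightarrow> 0"
    using IX IY unfolding is_ito_integral_def by simp_all
  from tendsto_in_probability_AE_subseq[of "\<lambda>n. ?S X n", OF mX IXm limX] obtain p :: "nat \<Rightarrow> nat"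
    where p: "strict_mono p" and aX: "AE \<omega> in M. (\<lambda>n. ?S X (p n) \<omega>) \<longlonglongrightarrow> IX \<omega>" .
  have "\<And>e. 0 < e \<Longrightarrow> (\<lambda>n. prob {\<omega>\<in>space M. norm (?S Y (p n) \<omega> - IY \<omega>) > e}) \<longlonglongrightarrow> 0"
    using LIMSEQ_subseq_LIMSEQ[OF limY p] by (simp add: comp_def)
  from tendsto_in_probability_AE_subseq[of "\<lambda>n. ?S Y (p n)", OF mY IYm this] obtain q :: "nat \<Rightarrow> nat"
    where q: "strict_mono q" and aY: "AE \<omega> in M. (\<lambda>n. ?S Y (p (q n)) \<omega>) \<longlonglongrightarrow> IY \<omega>" .
  define r where "r n = p (q n)" for n
  have r: "strict_mono r" using p q unfolding r_def strict_mono_def by simp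
  have "AE \<omega> in M. \<omega> \<in> good R t \<longrightarrow> (\<lambda>n. drift_sum R t (r n) \<omega> + noise_sum R t (r n) \<omega>) \<longlonglongrightarrow> X t \<omega> - Y t \<omega>"
    using aX aY eqX eqY X_paths Y_paths
  proof eventually_elim
    case (elim \<omega>)
    show ?case
    proof
      assume good: "\<omega> \<in> good R t"
      have that': "t * real k / 2^n \<le> t" if "k < 2^n" for k n :: nat
      proof -
        have "real k \<le> real (2^n)" using that by (simp only: of_nat_le_iff less_imp_le)
        then have "real k \<le> 2^n" by simp
        then show ?thesis using t mult_left_mono[of "real k" "2^n" t] by (simp add: divide_le_eq)
      qed
      have ind: "indicat_real (good R (t * real k / 2^n)) \<omega> = 1" if "k < 2^n" for k n :: nat
        by (rule indicator_simps(1)[OF subsetD[OF good_antimono[OF that'[OF that]] good]])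
      have drift: "drift_sum R t n \<omega> = (\<Sum>k<2^n. (t / 2^n) *\<^sub>R b (X (t * real k / 2^n) \<omega>))
          - (\<Sum>k<2^n. (t / 2^n) *\<^sub>R b (Y (t * real k / 2^n) \<omega>))" for n
        unfolding drift_sum_def sum_subtractf[symmetric]
        by (intro sum.cong refl) (simp add: ind scaleR_diff_right)
      have noise: "noise_sum R t n \<omega> = ?S X n \<omega> - ?S Y n \<omega>" for n
        unfolding noise_sum_def ito_riemann_sum_def sum_subtractf[symmetric]
        by (intro sum.cong refl) (simp add: ind matrix_vector_mult_diff_rdistrib)
      have cX: "continuous_on {0..t} (\<lambda>s. b (X s \<omega>))"
        by (rule continuous_on_compose2[OF b_cont continuous_on_subset[OF elim(5)]]) auto
      have cY: "continuous_on {0..t} (\<lambda>s. b (Y s \<omega>))"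
        by (rule continuous_on_compose2[OF b_cont continuous_on_subset[OF elim(6)]]) auto
      have "(\<lambda>n. drift_sum R t (r n) \<omega>) \<longlonglongrightarrow> integral {0..t} (\<lambda>s. b (X s \<omega>)) - integral {0..t} (\<lambda>s. b (Y s \<omega>))"
        unfolding drift
        using LIMSEQ_subseq_LIMSEQ[OF dyadic_riemann_sum_tendsto_integral[OF t cX] r]
          LIMSEQ_subseq_LIMSEQ[OF dyadic_riemann_sum_tendsto_integral[OF t cY] r]
        unfolding comp_def by (rule tendsto_diff)
      moreover have "(\<lambda>n. noise_sum R t (r n) \<omega>) \<longlonglongrightarrow> IX \<omega> - IY \<omega>"
        unfolding noise using LIMSEQ_subseq_LIMSEQ[OF elim(1) q] elim(2)
        unfolding comp_def r_def by (rule tendsto_diff)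
      ultimately have "(\<lambda>n. drift_sum R t (r n) \<omega> + noise_sum R t (r n) \<omega>) \<longlonglongrightarrow>
          (integral {0..t} (\<lambda>s. b (X s \<omega>)) - integral {0..t} (\<lambda>s. b (Y s \<omega>))) + (IX \<omega> - IY \<omega>)"
        by (rule tendsto_add)
      moreover have "(integral {0..t} (\<lambda>s. b (X s \<omega>)) - integral {0..t} (\<lambda>s. b (Y s \<omega>))) + (IX \<omega> - IY \<omega>)
          = X t \<omega> - Y t \<omega>"
        unfolding elim(3,4) by (simp add: algebra_simps)
      ultimately show "(\<lambda>n. drift_sum R t (r n) \<omega> + noise_sum R t (r n) \<omega>) \<longlonglongrightarrow> X t \<omega> - Y t \<omega>" by simp
    qed
  qed
  then show thesis by (rule that)
qed

lemma deviation_le: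
  assumes t: "0 \<le> t"
    and int: "\<And>n. integrable M (\<lambda>\<omega>. (norm (drift_sum R t n \<omega> + noise_sum R t n \<omega>))\<^sup>2)"
    and c: "\<And>n. expectation (\<lambda>\<omega>. (norm (drift_sum R t n \<omega> + noise_sum R t n \<omega>))\<^sup>2) \<le> c"
  shows "deviation R t \<le> c"
proof -
  obtain r :: "nat \<Rightarrow> nat" where lim: "AE \<omega> in M. \<omega> \<in> good R t \<longrightarrow>
      (\<lambda>n. drift_sum R t (r n) \<omega> + noise_sum R t (r n) \<omega>) \<longlonglongrightarrow> X t \<omega> - Y t \<omega>"
    using stopped_sums_tendsto[OF t] .
  show ?thesis unfolding deviation_def
  proof (rule integral_le_if_AE_tendsto[where g = "\<lambda>n \<omega>. (norm (drift_sum R t (r n) \<omega> + noise_sum R t (r n) \<omega>))\<^sup>2"])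
    show "AE \<omega> in M. indicat_real (good R t) \<omega> * (norm (X t \<omega> - Y t \<omega>))\<^sup>2 = 0 \<or>
        (\<lambda>n. (norm (drift_sum R t (r n) \<omega> + noise_sum R t (r n) \<omega>))\<^sup>2)
          \<longlonglongrightarrow> indicat_real (good R t) \<omega> * (norm (X t \<omega> - Y t \<omega>))\<^sup>2"
      using lim by eventually_elim (auto simp: indicator_def intro!: tendsto_intros)
  qed (use integrable_deviation[OF t] int c in auto)
qed

text \<open>The isometry reduces the second moment to those of the coefficient differences. Squaring
  the modulus by \<open>sum_power2_le\<close> turns \<open>sqrt (ln N)\<close> into
  \<open>ln N\<close> and produces the two factors 2. Positivity of \<open>t\<close> makes the
  partition points distinct.\<close>

lemma noise_sum_bound:
  assumes t: "0 < t" and N: "real N > exp 1" "R \<le> real N"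
  defines "\<epsilon> \<equiv> C * ln (real N) / real N powr \<mu>"
  shows "integrable M (\<lambda>\<omega>. (norm (noise_sum R t n \<omega>))\<^sup>2)"
    and "expectation (\<lambda>\<omega>. (norm (noise_sum R t n \<omega>))\<^sup>2)
      \<le> (\<Sum>k<2^n. (t / 2^n) * (2 * C\<^sup>2 * ln (real N) * deviation R (t * real k / 2^n) + 2 * \<epsilon>\<^sup>2))"
proof -
  define \<tau> where "\<tau> k = t * real k / 2^n" for k
  define H where "H k \<omega> = indicat_real (good R (\<tau> k)) \<omega> *\<^sub>R (\<sigma> (X (\<tau> k) \<omega>) - \<sigma> (Y (\<tau> k) \<omega>))" for k \<omega>
  have N1: "1 < real N" using N(1) exp_ge_add_one_self[of 1] by linarith
  have L: "0 < ln (real N)" using N1 by simp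
  have \<epsilon>: "0 \<le> \<epsilon>" using C_pos L by (simp add: \<epsilon>_def)
  have \<tau>0: "0 \<le> \<tau> k" for k using t by (simp add: \<tau>_def)
  have \<tau>m: "strict_mono \<tau>" using t by (auto simp: strict_mono_def \<tau>_def divide_strict_right_mono)
  have \<tau>d: "\<tau> (Suc k) - \<tau> k = t / 2^n" for k by (simp add: \<tau>_def field_simps)
  have Hm: "H k \<in> borel_measurable (FM (\<tau> k))" for k
    unfolding H_def
    by (intro borel_measurable_scaleR borel_measurable_indicator borel_measurable_diff
        coefficient_measurable \<tau>0 good_FM)
  have Hle: "norm (H k \<omega>) \<le> C * sqrt (ln (real N)) * (indicat_real (good R (\<tau> k)) \<omega> * norm (X (\<tau> k) \<omega> - Y (\<tau> k) \<omega>)) + \<epsilon>" for k \<omega>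
  proof (cases "\<omega> \<in> good R (\<tau> k)")
    case True
    have "norm (X (\<tau> k) \<omega>) \<le> real N" "norm (Y (\<tau> k) \<omega>) \<le> real N"
      using good_norm_le[OF True \<tau>0] N(2) by linarith+
    then show ?thesis using \<sigma>_modulus[OF N(1)] True by (simp add: H_def \<epsilon>_def)
  qed (use \<epsilon> in \<open>simp add: H_def\<close>)
  \<comment> \<open>The isometry asks for one deterministic bound for all \<open>k\<close>. A crude
    one suffices: on \<open>good\<close> both paths lie in the ball of radius \<open>N\<close>,
    elsewhere \<open>H k\<close> is 0.\<close>
  have Hb: "norm (H k \<omega>) \<le> C * sqrt (ln (real N)) * (2 * real N) + \<epsilon>" for k \<omega>
  proof -
    have "indicat_real (good R (\<tau> k)) \<omega> * norm (X (\<tau> k) \<omega> - Y (\<tau> k) \<omega>) \<le> 2 * real N"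
      using good_norm_le[of \<omega> R "\<tau> k"] \<tau>0[of k] N(2) norm_triangle_ineq4[of "X (\<tau> k) \<omega>" "Y (\<tau> k) \<omega>"]
      by (cases "\<omega> \<in> good R (\<tau> k)") auto
    then have "C * sqrt (ln (real N)) * (indicat_real (good R (\<tau> k)) \<omega> * norm (X (\<tau> k) \<omega> - Y (\<tau> k) \<omega>))
        \<le> C * sqrt (ln (real N)) * (2 * real N)"
      using C_pos L by (intro mult_left_mono) auto
    with Hle[of k \<omega>] show ?thesis by linarith
  qed
  have sum_eq: "noise_sum R t n \<omega> = (\<Sum>k<2^n. H k \<omega> *v (W (\<tau> (Suc k)) \<omega> - W (\<tau> k) \<omega>))" for \<omega>
    by (simp only: noise_sum_def H_def \<tau>_def)
  show "integrable M (\<lambda>\<omega>. (norm (noise_sum R t n \<omega>))\<^sup>2)"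
    unfolding sum_eq by (rule integrable_discrete_ito[OF \<tau>0 \<tau>m Hm Hb])
  have "expectation (\<lambda>\<omega>. (norm (noise_sum R t n \<omega>))\<^sup>2)
      = (\<Sum>k<2^n. (t / 2^n) * expectation (\<lambda>\<omega>. (norm (H k \<omega>))\<^sup>2))"
    unfolding sum_eq discrete_ito_isometry[OF \<tau>0 \<tau>m Hm Hb] \<tau>d ..
  also have "\<dots> \<le> (\<Sum>k<2^n. (t / 2^n) * (2 * C\<^sup>2 * ln (real N) * deviation R (\<tau> k) + 2 * \<epsilon>\<^sup>2))"
  proof (intro sum_mono mult_left_mono)
    fix k
    let ?d = "\<lambda>\<omega>. indicat_real (good R (\<tau> k)) \<omega> * (norm (X (\<tau> k) \<omega> - Y (\<tau> k) \<omega>))\<^sup>2"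
    have di: "integrable M (\<lambda>\<omega>. 2 * C\<^sup>2 * ln (real N) * ?d \<omega> + 2 * \<epsilon>\<^sup>2)"
      by (intro Bochner_Integration.integrable_add integrable_const integrable_mult_right integrable_deviation \<tau>0)
    have "expectation (\<lambda>\<omega>. (norm (H k \<omega>))\<^sup>2) \<le> expectation (\<lambda>\<omega>. 2 * C\<^sup>2 * ln (real N) * ?d \<omega> + 2 * \<epsilon>\<^sup>2)"
    proof (rule integral_mono[OF _ di])
      have [measurable]: "H k \<in> borel_measurable M" by (rule measurable_FM[OF Hm \<tau>0])
      show "integrable M (\<lambda>\<omega>. (norm (H k \<omega>))\<^sup>2)"
      proof (rule integrable_const_bound[where B = "(C * sqrt (ln (real N)) * (2 * real N) + \<epsilon>)\<^sup>2"])
        show "AE \<omega> in M. norm ((norm (H k \<omega>))\<^sup>2) \<le> (C * sqrt (ln (real N)) * (2 * real N) + \<epsilon>)\<^sup>2"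
        proof (rule AE_I2)
          fix \<omega>
          show "norm ((norm (H k \<omega>))\<^sup>2) \<le> (C * sqrt (ln (real N)) * (2 * real N) + \<epsilon>)\<^sup>2"
            unfolding real_norm_def abs_power2 by (rule power_mono[OF Hb norm_ge_zero])
        qed
      qed measurable
      fix \<omega>
      let ?D = "indicat_real (good R (\<tau> k)) \<omega> * norm (X (\<tau> k) \<omega> - Y (\<tau> k) \<omega>)"
      have D: "?D\<^sup>2 = ?d \<omega>" by (simp add: power_mult_distrib indicator_def)
      have "(norm (H k \<omega>))\<^sup>2 \<le> (C * sqrt (ln (real N)) * ?D + \<epsilon>)\<^sup>2"
        by (rule power_mono[OF Hle norm_ge_zero])
      also have "\<dots> \<le> 2 * (C * sqrt (ln (real N)) * ?D)\<^sup>2 + 2 * \<epsilon>\<^sup>2" by (rule sum_power2_le)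
      also have "(C * sqrt (ln (real N)) * ?D)\<^sup>2 = C\<^sup>2 * ln (real N) * ?D\<^sup>2"
        using L by (simp add: power_mult_distrib)
      finally show "(norm (H k \<omega>))\<^sup>2 \<le> 2 * C\<^sup>2 * ln (real N) * ?d \<omega> + 2 * \<epsilon>\<^sup>2"
        unfolding D by simp
    qed
    also have "\<dots> = 2 * C\<^sup>2 * ln (real N) * deviation R (\<tau> k) + 2 * \<epsilon>\<^sup>2"
      unfolding deviation_def using integrable_deviation[OF \<tau>0]
      by (subst Bochner_Integration.integral_add) (auto simp: prob_space)
    finally show "expectation (\<lambda>\<omega>. (norm (H k \<omega>))\<^sup>2) \<le> 2 * C\<^sup>2 * ln (real N) * deviation R (\<tau> k) + 2 * \<epsilon>\<^sup>2" .
  qed (use t in simp)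
  finally show "expectation (\<lambda>\<omega>. (norm (noise_sum R t n \<omega>))\<^sup>2)
      \<le> (\<Sum>k<2^n. (t / 2^n) * (2 * C\<^sup>2 * ln (real N) * deviation R (t * real k / 2^n) + 2 * \<epsilon>\<^sup>2))"
    by (simp only: \<tau>_def)
qed

text \<open>Stated pathwise and before squaring, so that the weight for Cauchy-Schwarz can still be
  chosen. The errors of the cells add up to the length \<open>t\<close>.\<close>

lemma drift_sum_bound:
  assumes t: "0 \<le> t" and N: "real N > exp 1" "R \<le> real N"
  shows "norm (drift_sum R t n \<omega>) \<le> C * ln (real N) * (\<Sum>k<2^n. (t / 2^n) *
      (indicat_real (good R (t * real k / 2^n)) \<omega> * norm (X (t * real k / 2^n) \<omega> - Y (t * real k / 2^n) \<omega>)))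
    + t * (C * ln (real N) / real N powr \<mu>)"
proof -
  define \<epsilon> where "\<epsilon> = C * ln (real N) / real N powr \<mu>"
  have N1: "1 < real N" using N(1) exp_ge_add_one_self[of 1] by linarith
  have L: "0 < ln (real N)" using N1 by simp
  have \<epsilon>: "0 \<le> \<epsilon>" using C_pos L by (simp add: \<epsilon>_def)
  have "norm (drift_sum R t n \<omega>) \<le> (\<Sum>k<2^n. (t / 2^n) * (C * ln (real N) *
      (indicat_real (good R (t * real k / 2^n)) \<omega> * norm (X (t * real k / 2^n) \<omega> - Y (t * real k / 2^n) \<omega>)) + \<epsilon>))"
    unfolding drift_sum_def
  proof (rule sum_norm_le)
    fix k
    define s where "s = t * real k / 2^n"
    have s: "0 \<le> s" using t by (simp add: s_def)
    have "norm (indicat_real (good R s) \<omega> *\<^sub>R (b (X s \<omega>) - b (Y s \<omega>)))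
        \<le> C * ln (real N) * (indicat_real (good R s) \<omega> * norm (X s \<omega> - Y s \<omega>)) + \<epsilon>"
    proof (cases "\<omega> \<in> good R s")
      case True
      have "norm (X s \<omega>) \<le> real N" "norm (Y s \<omega>) \<le> real N"
        using good_norm_le[OF True s] N(2) by linarith+
      then show ?thesis using b_modulus[OF N(1)] True by (simp add: \<epsilon>_def)
    qed (use \<epsilon> in simp)
    then have "(t / 2^n) * norm (indicat_real (good R s) \<omega> *\<^sub>R (b (X s \<omega>) - b (Y s \<omega>)))
        \<le> (t / 2^n) * (C * ln (real N) * (indicat_real (good R s) \<omega> * norm (X s \<omega> - Y s \<omega>)) + \<epsilon>)"
      using t by (intro mult_left_mono) auto
    then show "norm ((t / 2^n) *\<^sub>R (indicat_real (good R (t * real k / 2^n)) \<omega> *\<^sub>R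
          (b (X (t * real k / 2^n) \<omega>) - b (Y (t * real k / 2^n) \<omega>))))
        \<le> (t / 2^n) * (C * ln (real N) * (indicat_real (good R (t * real k / 2^n)) \<omega> *
            norm (X (t * real k / 2^n) \<omega> - Y (t * real k / 2^n) \<omega>)) + \<epsilon>)"
      using t unfolding s_def[symmetric] norm_scaleR[of "t / 2^n"] by simp
  qed
  also have "\<dots> = C * ln (real N) * (\<Sum>k<2^n. (t / 2^n) *
      (indicat_real (good R (t * real k / 2^n)) \<omega> * norm (X (t * real k / 2^n) \<omega> - Y (t * real k / 2^n) \<omega>)))
      + (\<Sum>k<(2::nat)^n. (t / 2^n) * \<epsilon>)"
    unfolding sum_distrib_left sum.distrib[symmetric] by (intro sum.cong refl) (simp only: distrib_left mult.left_commute)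
  also have "(\<Sum>k<(2::nat)^n. (t / 2^n) * \<epsilon>) = t * \<epsilon>" by simp
  finally show ?thesis unfolding \<epsilon>_def .
qed

lemma drift_sum_measurable: "0 \<le> t \<Longrightarrow> drift_sum R t n \<in> borel_measurable M"
  unfolding drift_sum_def
  by (intro borel_measurable_sum borel_measurable_scaleR borel_measurable_const borel_measurable_indicator
      borel_measurable_diff good_events measurable_FM[OF coefficient_measurable(3)]
      measurable_FM[OF coefficient_measurable(4)]) simp_all

lemma noise_sum_measurable: "0 \<le> t \<Longrightarrow> noise_sum R t n \<in> borel_measurable M"
  unfolding noise_sum_def
  by (intro borel_measurable_sum borel_measurable_matrix_vector_mult borel_measurable_scaleR
      borel_measurable_indicator borel_measurable_diff good_events W_measurable
      measurable_FM[OF coefficient_measurable(1)] measurable_FM[OF coefficient_measurable(2)]) simp_all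

lemma deviation_0: "deviation R 0 = 0"
proof -
  have "AE \<omega> in M. X 0 \<omega> = x" "AE \<omega> in M. Y 0 \<omega> = x"
    using X_sol Y_sol by (simp_all only: sde_solution_def)
  then have "AE \<omega> in M. indicat_real (good R 0) \<omega> * (norm (X 0 \<omega> - Y 0 \<omega>))\<^sup>2 = 0"
    by eventually_elim simp
  then show ?thesis unfolding deviation_def by (rule integral_eq_zero_AE)
qed

text \<open>The localized sum is split into the Lipschitz part of the drift, the error of the drift
  and the noise, whence the factors 3. The weighted squares give \<open>E / l\<close> twice for the
  drift, and the sum of squared weights gives \<open>E^2 / (2 * l)\<close> for the noise. The error
  terms amount to \<open>3 * t^2 + 6 * t\<close>, enlarged to \<open>T\<close> so that the constant
  is the same for all \<open>t\<close>.\<close>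

lemma deviation_bound:
  assumes N: "real N > exp 1" "R \<le> real N" and l: "0 < l" and v: "0 \<le> v" and t: "0 \<le> t" "t \<le> T"
    and dev: "\<And>s. 0 \<le> s \<Longrightarrow> s \<le> t \<Longrightarrow> deviation R s \<le> v * exp (2 * l * (s - s0))"
  shows "deviation R t \<le> (3 * C\<^sup>2 * (ln (real N))\<^sup>2 / l\<^sup>2 + 3 * C\<^sup>2 * ln (real N) / l) * (v * exp (2 * l * (t - s0)))
    + (3 * T\<^sup>2 + 6 * T) * (C * ln (real N) / real N powr \<mu>)\<^sup>2"
proof -
  define L where "L = ln (real N)"
  define \<epsilon> where "\<epsilon> = C * L / real N powr \<mu>"
  define E where "E = exp (l * (t - s0))"
  have E2: "exp (2 * l * (t - s0)) = E\<^sup>2" by (simp add: E_def power2_eq_square exp_add[symmetric])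
  have N1: "1 < real N" using N(1) exp_ge_add_one_self[of 1] by linarith
  have L: "0 < L" using N1 by (simp add: L_def)
  have E: "0 < E" by (simp add: E_def)
  have main: "deviation R t \<le> 3 * C\<^sup>2 * L\<^sup>2 * (E / l) * (v * E / l) + 3 * (t * \<epsilon>)\<^sup>2
      + 3 * (2 * C\<^sup>2 * L * (v * (E\<^sup>2 / (2 * l))) + 2 * t * \<epsilon>\<^sup>2)" if t0: "0 < t"
  proof -
    define \<tau> where "\<tau> n k = t * real k / 2^n" for n k :: nat
    define h where "h n = t / 2^n" for n :: nat
    \<comment> \<open>The weight has half the exponential rate of the assumed bound. Then
      \<open>deviation\<close> is at most \<open>v * w^2\<close> at the partition points, and
      dividing by the Cauchy-Schwarz weight leaves \<open>v * w\<close>, again summable with gain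
      \<open>1 / l\<close>.\<close>
    define w where "w n k = exp (l * (\<tau> n k - s0))" for n k
    define dd where "dd n k \<omega> = indicat_real (good R (\<tau> n k)) \<omega> * (norm (X (\<tau> n k) \<omega> - Y (\<tau> n k) \<omega>))\<^sup>2" for n k \<omega>
    \<comment> \<open>An integrable pathwise majorant of the squared sum. It provides both the
      integrability required by \<open>deviation_le\<close> and the bound on the
      expectation.\<close>
    define G where "G n \<omega> = 3 * C\<^sup>2 * L\<^sup>2 * (E / l) * (\<Sum>k<2^n. h n / w n k * dd n k \<omega>) + 3 * (t * \<epsilon>)\<^sup>2
      + 3 * (norm (noise_sum R t n \<omega>))\<^sup>2" for n \<omega>
    have h: "0 \<le> h n" for n using t by (simp add: h_def)
    have w: "0 < w n k" for n k by (simp add: w_def)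
    have \<tau>: "0 \<le> \<tau> n k" for n k using t by (simp add: \<tau>_def)
    have \<tau>t: "\<tau> n k \<le> t" if "k < 2^n" for n k
    proof -
      have "real k \<le> real (2^n)" using that by (simp only: of_nat_le_iff less_imp_le)
      then have "real k \<le> 2^n" by simp
      then show ?thesis using t mult_left_mono[of "real k" "2^n" t] by (simp add: \<tau>_def divide_le_eq)
    qed
    have sum_w: "(\<Sum>k<2^n. h n * w n k) \<le> E / l" for n
      unfolding h_def w_def \<tau>_def E_def by (rule dyadic_exp_sum_le[OF l t(1)])
    have sum_w2: "(\<Sum>k<2^n. h n * (w n k)\<^sup>2) \<le> E\<^sup>2 / (2 * l)" for n
      using dyadic_exp_sum_le[of "2 * l" t n s0] l t(1) unfolding E2[symmetric] h_def w_def \<tau>_def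
      by (simp add: power2_eq_square exp_add[symmetric] mult.assoc)
    have dev_w: "deviation R (\<tau> n k) \<le> v * (w n k)\<^sup>2" if "k < 2^n" for n k
      using dev[OF \<tau> \<tau>t[OF that]] by (simp add: w_def power2_eq_square exp_add[symmetric] mult.assoc)
    have gG: "(norm (drift_sum R t n \<omega> + noise_sum R t n \<omega>))\<^sup>2 \<le> G n \<omega>" for n \<omega>
    proof -
      define S where "S = (\<Sum>k<2^n. h n * (indicat_real (good R (\<tau> n k)) \<omega> * norm (X (\<tau> n k) \<omega> - Y (\<tau> n k) \<omega>)))"
      have "norm (drift_sum R t n \<omega>) \<le> C * L * S + t * \<epsilon>"
        using drift_sum_bound[OF t(1) N] unfolding S_def h_def \<tau>_def L_def \<epsilon>_def .
      then have "norm (drift_sum R t n \<omega> + noise_sum R t n \<omega>) \<le> C * L * S + t * \<epsilon> + norm (noise_sum R t n \<omega>)"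
        by (rule order_trans[OF norm_triangle_ineq add_right_mono])
      then have "(norm (drift_sum R t n \<omega> + noise_sum R t n \<omega>))\<^sup>2
          \<le> (C * L * S + t * \<epsilon> + norm (noise_sum R t n \<omega>))\<^sup>2"
        by (rule power_mono) simp
      also have "\<dots> \<le> 3 * (C * L * S)\<^sup>2 + 3 * (t * \<epsilon>)\<^sup>2 + 3 * (norm (noise_sum R t n \<omega>))\<^sup>2"
        by (rule sum3_power2_le)
      finally have sq: "(norm (drift_sum R t n \<omega> + noise_sum R t n \<omega>))\<^sup>2
          \<le> 3 * (C * L * S)\<^sup>2 + 3 * (t * \<epsilon>)\<^sup>2 + 3 * (norm (noise_sum R t n \<omega>))\<^sup>2" .
      have le: "3 * (C * L * S)\<^sup>2 \<le> 3 * C\<^sup>2 * L\<^sup>2 * (E / l) * (\<Sum>k<2^n. h n / w n k * dd n k \<omega>)"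
      proof -
        have "S\<^sup>2 \<le> (\<Sum>k<2^n. h n * w n k) * (\<Sum>k<2^n. h n *
            (indicat_real (good R (\<tau> n k)) \<omega> * norm (X (\<tau> n k) \<omega> - Y (\<tau> n k) \<omega>))\<^sup>2 / w n k)"
          unfolding S_def by (rule weighted_sum_squared_le) (rule w h)+
        also have "(\<Sum>k<2^n. h n * (indicat_real (good R (\<tau> n k)) \<omega> * norm (X (\<tau> n k) \<omega> - Y (\<tau> n k) \<omega>))\<^sup>2 / w n k)
            = (\<Sum>k<2^n. h n / w n k * dd n k \<omega>)"
          by (intro sum.cong refl) (simp add: dd_def indicator_def)
        also have "(\<Sum>k<2^n. h n * w n k) * (\<Sum>k<2^n. h n / w n k * dd n k \<omega>)
            \<le> E / l * (\<Sum>k<2^n. h n / w n k * dd n k \<omega>)"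
          by (intro mult_right_mono sum_w sum_nonneg mult_nonneg_nonneg divide_nonneg_pos h w)
            (simp add: dd_def)
        finally have "3 * C\<^sup>2 * L\<^sup>2 * S\<^sup>2 \<le> 3 * C\<^sup>2 * L\<^sup>2 * (E / l * (\<Sum>k<2^n. h n / w n k * dd n k \<omega>))"
          by (intro mult_left_mono) auto
        then show ?thesis by (simp only: power_mult_distrib mult.assoc)
      qed
      from add_right_mono[OF add_right_mono[OF this]] show ?thesis unfolding G_def by (rule order_trans[OF sq])
    qed
    have ddi: "integrable M (dd n k)" for n k
      unfolding dd_def by (rule integrable_deviation[OF \<tau>])
    have Edd: "expectation (dd n k) = deviation R (\<tau> n k)" for n k
      by (simp add: dd_def[abs_def] deviation_def)
    have Gi: "integrable M (G n)" for n
      unfolding G_def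
      by (intro Bochner_Integration.integrable_add integrable_mult_right integrable_const
          Bochner_Integration.integrable_sum ddi noise_sum_bound(1)[OF t0 N])
    have EG: "expectation (G n) \<le> 3 * C\<^sup>2 * L\<^sup>2 * (E / l) * (v * E / l) + 3 * (t * \<epsilon>)\<^sup>2
      + 3 * (2 * C\<^sup>2 * L * (v * (E\<^sup>2 / (2 * l))) + 2 * t * \<epsilon>\<^sup>2)" for n
    proof -
      have eq: "expectation (G n) = 3 * C\<^sup>2 * L\<^sup>2 * (E / l) * (\<Sum>k<2^n. h n / w n k * deviation R (\<tau> n k)) + 3 * (t * \<epsilon>)\<^sup>2
          + 3 * expectation (\<lambda>\<omega>. (norm (noise_sum R t n \<omega>))\<^sup>2)"
        unfolding G_def using ddi noise_sum_bound(1)[OF t0 N] by (simp add: Edd prob_space)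
      have drift: "(\<Sum>k<2^n. h n / w n k * deviation R (\<tau> n k)) \<le> v * E / l"
      proof -
        have "(\<Sum>k<2^n. h n / w n k * deviation R (\<tau> n k)) \<le> (\<Sum>k<2^n. h n / w n k * (v * (w n k)\<^sup>2))"
          using h w by (intro sum_mono mult_left_mono dev_w) (auto simp: less_imp_le)
        also have "\<dots> = v * (\<Sum>k<2^n. h n * w n k)"
          unfolding sum_distrib_left using w by (intro sum.cong refl) (simp add: power2_eq_square less_imp_neq[symmetric])
        also have "\<dots> \<le> v * (E / l)" by (intro mult_left_mono sum_w v)
        finally show ?thesis by simp
      qed
      have noise: "expectation (\<lambda>\<omega>. (norm (noise_sum R t n \<omega>))\<^sup>2) \<le> 2 * C\<^sup>2 * L * (v * (E\<^sup>2 / (2 * l))) + 2 * t * \<epsilon>\<^sup>2"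
      proof -
        have "expectation (\<lambda>\<omega>. (norm (noise_sum R t n \<omega>))\<^sup>2)
            \<le> (\<Sum>k<2^n. h n * (2 * C\<^sup>2 * L * deviation R (\<tau> n k) + 2 * \<epsilon>\<^sup>2))"
          using noise_sum_bound(2)[OF t0 N] unfolding h_def \<tau>_def L_def \<epsilon>_def .
        also have "\<dots> \<le> (\<Sum>k<2^n. h n * (2 * C\<^sup>2 * L * (v * (w n k)\<^sup>2) + 2 * \<epsilon>\<^sup>2))"
          using L h by (intro sum_mono mult_left_mono add_right_mono dev_w) auto
        also have "\<dots> = 2 * C\<^sup>2 * L * (v * (\<Sum>k<2^n. h n * (w n k)\<^sup>2)) + (\<Sum>k<(2::nat)^n. h n * (2 * \<epsilon>\<^sup>2))"
          unfolding sum_distrib_left sum.distrib[symmetric] by (intro sum.cong refl) (simp only: distrib_left mult.left_commute)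
        also have "(\<Sum>k<(2::nat)^n. h n * (2 * \<epsilon>\<^sup>2)) = 2 * t * \<epsilon>\<^sup>2" by (simp add: h_def)
        also have "2 * C\<^sup>2 * L * (v * (\<Sum>k<2^n. h n * (w n k)\<^sup>2)) + 2 * t * \<epsilon>\<^sup>2
            \<le> 2 * C\<^sup>2 * L * (v * (E\<^sup>2 / (2 * l))) + 2 * t * \<epsilon>\<^sup>2"
          using L v by (intro add_right_mono mult_left_mono sum_w2) auto
        finally show ?thesis .
      qed
      have "0 \<le> 3 * C\<^sup>2 * L\<^sup>2 * (E / l)" using l E by simp
      note d = mult_left_mono[OF drift this]
      show ?thesis unfolding eq by (rule add_mono[OF add_right_mono[OF d] mult_left_mono[OF noise]]) simp
    qed
    have int: "integrable M (\<lambda>\<omega>. (norm (drift_sum R t n \<omega> + noise_sum R t n \<omega>))\<^sup>2)" for n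
    proof (rule Bochner_Integration.integrable_bound[OF Gi])
      show "(\<lambda>\<omega>. (norm (drift_sum R t n \<omega> + noise_sum R t n \<omega>))\<^sup>2) \<in> borel_measurable M"
        using drift_sum_measurable[OF t(1)] noise_sum_measurable[OF t(1)] by measurable
      show "AE \<omega> in M. norm ((norm (drift_sum R t n \<omega> + noise_sum R t n \<omega>))\<^sup>2) \<le> norm (G n \<omega>)"
      proof (rule AE_I2)
        fix \<omega>
        show "norm ((norm (drift_sum R t n \<omega> + noise_sum R t n \<omega>))\<^sup>2) \<le> norm (G n \<omega>)"
          unfolding real_norm_def abs_power2 by (rule order_trans[OF gG abs_ge_self])
      qed
    qed
    show ?thesis
      by (rule deviation_le[OF t(1) int]) (rule order_trans[OF integral_mono[OF int Gi gG] EG])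
  qed
  show ?thesis
  \<comment> \<open>The noise estimate needs a nondegenerate partition; at time 0 the common initial
    value gives the claim directly.\<close>
  proof (cases "t = 0")
    case True
    have "0 \<le> (3 * C\<^sup>2 * L\<^sup>2 / l\<^sup>2 + 3 * C\<^sup>2 * L / l) * (v * exp (2 * l * (t - s0))) + (3 * T\<^sup>2 + 6 * T) * \<epsilon>\<^sup>2"
      using L l v t by (intro add_nonneg_nonneg mult_nonneg_nonneg) auto
    then show ?thesis using True deviation_0[of R] by (simp add: L_def \<epsilon>_def)
  next
    case False
    have "3 * C\<^sup>2 * L\<^sup>2 * (E / l) * (v * E / l) + 3 * (t * \<epsilon>)\<^sup>2
      + 3 * (2 * C\<^sup>2 * L * (v * (E\<^sup>2 / (2 * l))) + 2 * t * \<epsilon>\<^sup>2)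
      = (3 * C\<^sup>2 * L\<^sup>2 / l\<^sup>2 + 3 * C\<^sup>2 * L / l) * (v * E\<^sup>2) + (3 * t\<^sup>2 + 6 * t) * \<epsilon>\<^sup>2"
      using l by (simp add: power2_eq_square field_simps)
    also have "\<dots> \<le> (3 * C\<^sup>2 * L\<^sup>2 / l\<^sup>2 + 3 * C\<^sup>2 * L / l) * (v * E\<^sup>2) + (3 * T\<^sup>2 + 6 * T) * \<epsilon>\<^sup>2"
      using t by (intro add_left_mono mult_right_mono add_mono mult_left_mono power_mono) auto
    finally show ?thesis using main False t unfolding E2 L_def[symmetric] \<epsilon>_def[symmetric] by linarith
  qed
qed

section \<open>Vanishing deviation and equality of paths\<close>

lemma deviation_eq_0:
  assumes "0 \<le> t"
  shows "deviation R t = 0"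
proof -
  \<comment> \<open>The 4 guarantees \<open>n > exp 1\<close>, because \<open>exp 1 \<le> 3\<close>;
    the other entry guarantees \<open>R \<le> n\<close>. Both persist for all larger
    \<open>N\<close>.\<close>
  obtain n :: nat where "max 4 \<bar>R\<bar> \<le> real n" using real_arch_simple by blast
  then have n: "4 \<le> real n" "R \<le> real n" by auto
  have big: "real N > exp 1" "R \<le> real N" if "n \<le> N" for N
  proof -
    have "real n \<le> real N" using that by simp
    then show "real N > exp 1" "R \<le> real N" using n exp_le by linarith+
  qed
  show ?thesis
  \<comment> \<open>The horizon is the target time \<open>t\<close> itself, so the constant
    \<open>c\<close> is fixed while the intermediate time \<open>u\<close> varies.\<close>
  proof (rule log_gronwall[where \<phi> = "deviation R" and ?N0.0 = n and c = "3 * t\<^sup>2 + 6 * t",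
        OF C_pos \<mu>_pos deviation_nonneg deviation_le_bound])
    show "deviation R u \<le> (3 * C\<^sup>2 * (ln (real N))\<^sup>2 / l\<^sup>2 + 3 * C\<^sup>2 * ln (real N) / l) * (v * exp (2 * l * (u - s0)))
        + (3 * t\<^sup>2 + 6 * t) * (C * ln (real N) / real N powr \<mu>)\<^sup>2"
      if "n \<le> N" "0 < l" "0 \<le> v" "0 \<le> u" "u \<le> t"
        "\<And>s. 0 \<le> s \<Longrightarrow> s \<le> u \<Longrightarrow> deviation R s \<le> v * exp (2 * l * (s - s0))" for N l v s0 u
      by (rule deviation_bound[OF big[OF that(1)] that(2-)])
  qed (use assms deviation_0 in auto)
qed

text \<open>A continuous real path is bounded on \<open>[0, T]\<close>, so almost every \<omega>
  lies in \<open>good R\<close> up to \<open>T\<close> for some natural \<open>R\<close> depending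
  on \<omega>. Only countably many levels and times occur, so the exceptional sets still form a null
  set.\<close>

lemma paths_agree: "AE \<omega> in M. \<forall>t\<in>{0..T}. X t \<omega> = Y t \<omega>"
proof -
  \<comment> \<open>No sign of \<open>T\<close> is assumed here, and the deviation is known to
    vanish only at nonnegative times; hence the intersection with \<open>{0..}\<close>.\<close>
  let ?Q = "insert T (\<rat> \<inter> {0..T}) \<inter> {0..}"
  have "AE \<omega> in M. indicat_real (good R t) \<omega> * (norm (X t \<omega> - Y t \<omega>))\<^sup>2 = 0" if t: "0 \<le> t" for R t
    using deviation_eq_0[OF t, of R] integral_nonneg_eq_0_iff_AE[OF integrable_deviation[OF t, of R]]
    unfolding deviation_def by simp
  then have "AE \<omega> in M. \<forall>R::nat. \<forall>t\<in>?Q. indicat_real (good (real R) t) \<omega> * (norm (X t \<omega> - Y t \<omega>))\<^sup>2 = 0"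
    unfolding AE_all_countable
    by (intro allI AE_ball_countable') (auto intro: countable_rat countable_Int1)
  then show ?thesis
    using X_paths Y_paths AE_space
  proof eventually_elim
    case (elim \<omega>)
    have cX: "continuous_on {0..T} (\<lambda>t. X t \<omega>)" and cY: "continuous_on {0..T} (\<lambda>t. Y t \<omega>)"
      using elim(2,3) by (auto intro: continuous_on_subset)
    obtain A where A: "\<forall>t\<in>{0..T}. norm (X t \<omega>) \<le> A"
      using compact_imp_bounded[OF compact_continuous_image[OF cX compact_Icc]] unfolding bounded_iff by auto
    obtain B where B: "\<forall>t\<in>{0..T}. norm (Y t \<omega>) \<le> B"
      using compact_imp_bounded[OF compact_continuous_image[OF cY compact_Icc]] unfolding bounded_iff by auto
    obtain R :: nat where R: "max A B \<le> real R" using real_arch_simple by blast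
    have good: "\<omega> \<in> good (real R) t" if "t \<in> {0..T}" for t
    proof -
      have "norm (X r \<omega>) \<le> real R \<and> norm (Y r \<omega>) \<le> real R" if "r \<in> {0..t}" for r
      proof -
        have "r \<in> {0..T}" using that \<open>t \<in> {0..T}\<close> by simp
        with A B have "norm (X r \<omega>) \<le> A" "norm (Y r \<omega>) \<le> B" by blast+
        then show ?thesis using R by simp
      qed
      then show ?thesis using elim(4) by (simp add: good_def)
    qed
    have "X t \<omega> = Y t \<omega>" if t: "t \<in> {0..T}" for t
    proof -
      have "norm (X t \<omega> - Y t \<omega>) \<le> 0"
      proof (rule norm_le_if_norm_le_on_rationals[OF continuous_on_diff[OF cX cY] _ t])
        fix r assume r: "r \<in> insert T (\<rat> \<inter> {0..T})"
        then have "r \<in> {0..T}" using t by auto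
        with r have "r \<in> ?Q" by auto
        with elim(1) have "indicat_real (good (real R) r) \<omega> * (norm (X r \<omega> - Y r \<omega>))\<^sup>2 = 0" by blast
        then show "norm (X r \<omega> - Y r \<omega>) \<le> 0" using good[OF \<open>r \<in> {0..T}\<close>] by simp
      qed
      then show ?thesis by simp
    qed
    then show ?case by blast
  qed
qed

end

theorem theorem2p1:
  fixes M :: "'a measure" and F :: "real \<Rightarrow> 'a set set"
    and W :: "real \<Rightarrow> 'a \<Rightarrow> real^'m"
    and \<sigma> :: "real^'d \<Rightarrow> real^'m^'d" and b :: "real^'d \<Rightarrow> real^'d"
    and x :: "real^'d" and X Y :: "real \<Rightarrow> 'a \<Rightarrow> real^'d"
    and C \<mu> T :: real
  assumes "prob_space M" and "complete_measure_space M"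
    and "usual_filtration M F" and "brownian_motion M F W"
    and "continuous_on UNIV \<sigma>" and "continuous_on UNIV b"
    and "C > 0" and "\<mu> > 0"
    and "\<And>(N::nat) y z. real N > exp 1 \<Longrightarrow> norm y \<le> real N \<Longrightarrow> norm z \<le> real N \<Longrightarrow>
           norm (\<sigma> y - \<sigma> z) \<le> C * sqrt (ln (real N)) * norm (y - z) + C * ln (real N) / real N powr \<mu>"
    and "\<And>(N::nat) y z. real N > exp 1 \<Longrightarrow> norm y \<le> real N \<Longrightarrow> norm z \<le> real N \<Longrightarrow>
           norm (b y - b z) \<le> C * ln (real N) * norm (y - z) + C * ln (real N) / real N powr \<mu>"
    and "sde_solution M F W \<sigma> b x X" and "sde_solution M F W \<sigma> b x Y"
    and "T > 0"
  shows "AE \<omega> in M. \<forall>t\<in>{0..T}. X t \<omega> = Y t \<omega>"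
proof -
  interpret sde_pair M F W \<sigma> b x X Y C \<mu>
    by (intro sde_pair.intro brownian_space.intro brownian_space_axioms.intro sde_pair_axioms.intro) fact+
  show ?thesis by (rule paths_agree)
qed

end
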